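(* Let $q$ be a power of an odd prime with $q\ge 7$ and $q\equiv 1\pmod 3$, and let $R$ be the graph defined below over $\mathbb F_q$. Then: (i) for any line $[A,B,C]$ of $R$ with $(A,B)\neq(0,0)$ and $(A,B)\neq(0,1)$, we have $r_3([A,B,C]) < r_3([0,0,0]) < r_3([0,1,0])$; (ii) for any point $(p_1,p_2,p_3)$ of $R$, we have $r_3((p_1,p_2,p_3)) < r_3([0,0,0])$.
   Context: $R$ is the bipartite graph whose parts are the set of points $(p_1,p_2,p_3)\in\mathbb F_q^3$ and the set of lines $[l_1,l_2,l_3]\in\mathbb F_q^3$ (two disjoint copies of $\mathbb F_q^3$), where $(p_1,p_2,p_3)$ is adjacent to $[l_1,l_2,l_3]$ if and only if $p_2+l_2 = p_1l_1$ and $p_3+l_3 = p_1p_2l_1(p_1+p_2+p_1p_2)$. For a vertex $v$, $r_3(v)$ denotes the number of vertices of $R$ at graph distance exactly $3$ from $v$. *)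

theory Defs
  imports Complex_Main "HOL-Library.Extended_Nat" "HOL-Library.Cardinality" "HOL-Computational_Algebra.Primes"
    "HOL-Number_Theory.Cong"
begin

datatype 'a vertex = Point 'a 'a 'a | Line 'a 'a 'a

definition incident :: "'a::field \<times> 'a \<times> 'a \<Rightarrow> 'a \<times> 'a \<times> 'a \<Rightarrow> bool" where
  "incident = (\<lambda>(p1, p2, p3) (l1, l2, l3).
     p2 + l2 = p1 * l1 \<and> p3 + l3 = p1 * p2 * l1 * (p1 + p2 + p1 * p2))"

fun R_adj :: "'a::field vertex \<Rightarrow> 'a vertex \<Rightarrow> bool" where
  "R_adj (Point p1 p2 p3) (Line l1 l2 l3) = incident (p1, p2, p3) (l1, l2, l3)"
| "R_adj (Line l1 l2 l3) (Point p1 p2 p3) = incident (p1, p2, p3) (l1, l2, l3)"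
| "R_adj (Point _ _ _) (Point _ _ _) = False"
| "R_adj (Line _ _ _) (Line _ _ _) = False"

text \<open>The length of a shortest walk; the infimum over the empty set is \<open>\<infinity>\<close>, so vertices in
  different components have infinite distance.\<close>
definition graph_dist :: "('v \<Rightarrow> 'v \<Rightarrow> bool) \<Rightarrow> 'v \<Rightarrow> 'v \<Rightarrow> enat" where
  "graph_dist E u v = (INF n\<in>{n::nat. (E ^^ n) u v}. enat n)"

definition r\<^sub>3 :: "'a::{field,finite} vertex \<Rightarrow> nat" where
  "r\<^sub>3 v = card {w. graph_dist R_adj v w = 3}"

end

theory Submission
  imports Defs "HOL-Computational_Algebra.Polynomial"
begin

text \<open>
  Write \<open>g(x,y) = xy(x + y + xy)\<close>.  Fix the first two coordinates of the end point of a path of length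
  three.  The third coordinate is then an affine function of the slope \<open>(g(Q) - g(P)) / (Q\<^sub>1 - P\<^sub>1)\<close>, where
  \<open>P = (a,b)\<close> is a point of the affine plane, \<open>Q\<close> runs over a non-vertical affine line \<open>\<ell>\<close> that misses \<open>P\<close>,
  and \<open>Q\<^sub>1 \<noteq> P\<^sub>1\<close>.  Hence \<open>r\<^sub>3\<close> of a line (a point) of the graph is the sum, over all \<open>P\<close> off the
  corresponding \<open>\<ell>\<close> (all \<open>\<ell>\<close> off the corresponding \<open>P\<close>), of the number of distinct slopes.

  For horizontal \<open>\<ell>\<close> these numbers are elementary.  Otherwise the slope is a Laurent polynomial
  \<open>\<alpha>s\<^sup>3 + \<beta>s\<^sup>2 + \<kappa>s + \<delta> + \<gamma>/s\<close> with \<open>\<alpha> \<noteq> 0\<close>, and it suffices that it always omits at least three elements of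
  the field.  If it omitted at most two, its power sums over \<open>s \<noteq> 0\<close> would be \<open>v\<^sup>k - m\<^sub>1\<^sup>k - m\<^sub>2\<^sup>k\<close>; they are
  also minus the constant terms of its powers as long as \<open>3k < q - 1\<close>, and the first eight of these
  equations are contradictory.  For \<open>\<gamma> = 0\<close> one uses \<open>k = (q - 1)/3\<close> instead, which is where
  \<open>q \<equiv> 1 (mod 3)\<close> enters.  The fields with 7, 13 and 19 elements are too small for the argument and are
  treated by computation.
\<close>

section \<open>Vertices at distance three\<close>

lemma graph_dist_eq_enat_iff:
  "graph_dist E u v = enat n \<longleftrightarrow> (E ^^ n) u v \<and> (\<forall>m<n. \<not> (E ^^ m) u v)"
proof -
  let ?S = "{n. (E ^^ n) u v}"
  show ?thesis
  proof (cases "?S = {}")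
    case True
    then show ?thesis
      by (simp add: graph_dist_def top_enat_def)
  next
    case False
    define k where "k = (LEAST n. (E ^^ n) u v)"
    from False have k: "(E ^^ k) u v" and least: "\<And>m. (E ^^ m) u v \<Longrightarrow> k \<le> m"
      unfolding k_def by (auto intro: LeastI Least_le)
    have "graph_dist E u v = enat k"
      unfolding graph_dist_def
    proof (rule antisym)
      show "(INF n\<in>?S. enat n) \<le> enat k"
        using k by (intro INF_lower) auto
      show "enat k \<le> (INF n\<in>?S. enat n)"
        using least by (intro INF_greatest) auto
    qed
    moreover have "k = n \<longleftrightarrow> (E ^^ n) u v \<and> (\<forall>m<n. \<not> (E ^^ m) u v)"
      using k least by (metis leD linorder_neqE_nat order_antisym_conv not_less)
    ultimately show ?thesis
      by simp
  qed
qed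

fun same_side :: "'a vertex \<Rightarrow> 'a vertex \<Rightarrow> bool" where
  "same_side (Point _ _ _) (Point _ _ _) = True"
| "same_side (Line _ _ _) (Line _ _ _) = True"
| "same_side _ _ = False"

lemma R_adj_opposite: "R_adj u v \<Longrightarrow> \<not> same_side u v"
  by (cases u; cases v) auto

lemma R_adj_sides: "R_adj u v \<Longrightarrow> same_side u w \<longleftrightarrow> \<not> same_side v w"
  by (cases u; cases v; cases w) auto

text \<open>A walk of length three ends on the other side of the bipartition, which rules out walks
  of length 0 and 2 with the same ends. Only adjacency remains to be excluded.\<close>

lemma graph_dist_R_adj_3_iff:
  "graph_dist R_adj u w = 3 \<longleftrightarrow>
    (\<exists>x y. R_adj u x \<and> R_adj x y \<and> R_adj y w) \<and> \<not> R_adj u w"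
proof -
  have three: "(R_adj ^^ 3) u w \<longleftrightarrow> (\<exists>x y. R_adj u x \<and> R_adj x y \<and> R_adj y w)"
    by (auto simp: numeral_3_eq_3 OO_def)
  have two: "(R_adj ^^ 2) u w \<longleftrightarrow> (\<exists>x. R_adj u x \<and> R_adj x w)"
    by (auto simp: numeral_2_eq_2 OO_def)
  have side: "same_side v v" for v :: "'a vertex"
    by (cases v) auto
  have "graph_dist R_adj u w = 3 \<longleftrightarrow>
      (R_adj ^^ 3) u w \<and> u \<noteq> w \<and> \<not> R_adj u w \<and> \<not> (R_adj ^^ 2) u w"
  proof -
    have three: "(3 :: enat) = enat 3"
      by (simp add: numeral_eq_enat)
    have below: "(\<forall>m<3. \<not> (R_adj ^^ m) u w) \<longleftrightarrow>
        \<not> (R_adj ^^ 0) u w \<and> \<not> (R_adj ^^ 1) u w \<and> \<not> (R_adj ^^ 2) u w"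
      by (auto simp: less_Suc_eq numeral_3_eq_3 numeral_2_eq_2)
    show ?thesis
      unfolding three graph_dist_eq_enat_iff below by auto
  qed
  also have "\<dots> \<longleftrightarrow> (\<exists>x y. R_adj u x \<and> R_adj x y \<and> R_adj y w) \<and> \<not> R_adj u w"
    unfolding three two by (metis R_adj_opposite R_adj_sides side)
  finally show ?thesis .
qed

section \<open>Third coordinates of end points as slopes of chords of \<open>g\<close>\<close>

definition g :: "'a::field \<Rightarrow> 'a \<Rightarrow> 'a" where
  "g x y = x * y * (x + y + x * y)"

lemma incident_iff:
  "incident (p1, p2, p3) (l1, l2, l3) \<longleftrightarrow> l2 = p1 * l1 - p2 \<and> l3 = l1 * g p1 p2 - p3"
  unfolding incident_def g_def by (auto simp: algebra_simps)

lemma incident_iff':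
  "incident (p1, p2, p3) (l1, l2, l3) \<longleftrightarrow> p2 = p1 * l1 - l2 \<and> p3 = l1 * g p1 p2 - l3"
  unfolding incident_def g_def by (auto simp: algebra_simps)

lemma vertex_ex_iff: "(\<exists>v. P v) \<longleftrightarrow> (\<exists>x y z. P (Point x y z)) \<or> (\<exists>x y z. P (Line x y z))"
  by (metis vertex.exhaust)

text \<open>Along a path \<open>[A,B,C]\<close>, \<open>(x,u,u')\<close>, \<open>[y,n,n']\<close>,
  \<open>(z,w,t)\<close> elimination gives \<open>w - (A * z - B) = (z - x) * (y - A)\<close>, and
  the ends are adjacent as soon as \<open>x = z\<close> or \<open>y = A\<close>. With
  \<open>s = x - z\<close>, the plane point \<open>(x, u)\<close> runs over the line
  \<open>u = A * x - B\<close>, and \<open>t\<close> is affine in the slope of the chord of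
  \<open>g\<close> from \<open>(z, w)\<close> to \<open>(x, u)\<close>.\<close>

lemma dist_3_Line_iff:
  fixes A B C :: "'a::field"
  shows "graph_dist R_adj (Line A B C) (Point z w t) = 3 \<longleftrightarrow>
    w \<noteq> A * z - B \<and> (\<exists>s. s \<noteq> 0 \<and>
      t = A * g z w - C + (w - (A * z - B)) * ((g (z + s) (A * s + (A * z - B)) - g z w) / s))"
    (is "_ \<longleftrightarrow> ?R")
proof -
  have "graph_dist R_adj (Line A B C) (Point z w t) = 3 \<longleftrightarrow>
      (\<exists>x u u' y n n'. u = x * A - B \<and> u' = A * g x u - C \<and>
        n = x * y - u \<and> n' = y * g x u - u' \<and> w = z * y - n \<and> t = y * g z w - n') \<and>
      \<not> (w = z * A - B \<and> t = A * g z w - C)" (is "_ \<longleftrightarrow> ?L")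
    unfolding graph_dist_R_adj_3_iff vertex_ex_iff
      R_adj.simps simp_thms ex_simps incident_iff'[of _ _ _ A B C] incident_iff'[of z w t]
    unfolding incident_iff by blast
  also have "?L \<longleftrightarrow> ?R"
  proof
    assume ?L
    then obtain x y where xy: "w = z * y - (x * y - (x * A - B))"
      "t = y * g z w - (y * g x (x * A - B) - (A * g x (x * A - B) - C))"
      and non: "\<not> (w = z * A - B \<and> t = A * g z w - C)"
      by blast
    have *: "w - (A * z - B) = (z - x) * (y - A)"
      unfolding xy(1) by (simp add: algebra_simps)
    have "x \<noteq> z"
    proof
      assume "x = z"
      with xy(1) have "w = z * A - B"
        by simp
      with xy(2) non \<open>x = z\<close> show False
        by simp
    qed
    moreover have "y \<noteq> A"
      using xy non by (auto simp: algebra_simps)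
    ultimately have "w \<noteq> A * z - B"
      using * by auto
    moreover have "t = A * g z w - C + (w - (A * z - B)) *
        ((g (z + (x - z)) (A * (x - z) + (A * z - B)) - g z w) / (x - z))"
    proof -
      have 1: "A * (x - z) + (A * z - B) = x * A - B" "z + (x - z) = x"
        by (simp_all add: algebra_simps)
      show ?thesis
        unfolding * 1 xy(2) using \<open>x \<noteq> z\<close> by (simp add: field_simps)
    qed
    ultimately show ?R
      using \<open>x \<noteq> z\<close> by (metis right_minus_eq)
  next
    assume ?R
    then obtain s where s: "s \<noteq> 0" and w: "w \<noteq> A * z - B"
      and t: "t = A * g z w - C +
        (w - (A * z - B)) * ((g (z + s) (A * s + (A * z - B)) - g z w) / s)"
      by blast
    define x where "x = z + s"
    \<comment> \<open>This solves the factorisation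
      \<open>w - (A * z - B) = (z - x) * (y - A)\<close> for \<open>y\<close>, with
      \<open>z - x = - s\<close>.\<close>
    define y where "y = A - (w - (A * z - B)) / s"
    have x: "A * s + (A * z - B) = x * A - B"
      by (simp add: x_def algebra_simps)
    have "w = z * y - (x * y - (x * A - B))"
      using s by (simp add: x_def y_def field_simps)
    moreover have "t = y * g z w - (y * g x (x * A - B) - (A * g x (x * A - B) - C))"
      unfolding t x x_def[symmetric] using s by (simp add: y_def field_simps)
    moreover have "w \<noteq> z * A - B"
      using w by (simp add: mult.commute)
    ultimately show ?L
      by blast
  qed
  finally show ?thesis .
qed

text \<open>The dual elimination: \<open>(a, b)\<close> is now the fixed end of the chord and the
  middle point \<open>(x, v)\<close> runs over \<open>v = m * x - n\<close>. The same slopes appear,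
  so one counting function serves both kinds of vertices.\<close>

lemma dist_3_Point_iff:
  fixes a b c :: "'a::field"
  shows "graph_dist R_adj (Point a b c) (Line m n t) = 3 \<longleftrightarrow>
    a * m - n \<noteq> b \<and> (\<exists>s. s \<noteq> 0 \<and>
      t = m * g a b - c + (b - (a * m - n)) * ((g (a + s) (m * s + (a * m - n)) - g a b) / s))"
    (is "_ \<longleftrightarrow> ?R")
proof -
  have "graph_dist R_adj (Point a b c) (Line m n t) = 3 \<longleftrightarrow>
      (\<exists>y u u' x v v'. u = a * y - b \<and> u' = y * g a b - c \<and>
        v = x * y - u \<and> v' = y * g x v - u' \<and> n = x * m - v \<and> t = m * g x v - v') \<and>
      \<not> (n = a * m - b \<and> t = m * g a b - c)" (is "_ \<longleftrightarrow> ?L")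
    unfolding graph_dist_R_adj_3_iff vertex_ex_iff
      R_adj.simps simp_thms ex_simps incident_iff[of a b c] incident_iff[of _ _ _ m n t]
    unfolding incident_iff' by blast
  also have "?L \<longleftrightarrow> ?R"
  proof
    assume ?L
    then obtain x y where xy: "n = x * m - (x * y - (a * y - b))"
      "t = m * g x (x * y - (a * y - b)) - (y * g x (x * y - (a * y - b)) - (y * g a b - c))"
      and non: "\<not> (n = a * m - b \<and> t = m * g a b - c)"
      by blast
    have *: "b - (a * m - n) = (x - a) * (m - y)"
      unfolding xy(1) by (simp add: algebra_simps)
    have "x \<noteq> a"
      using xy non by (auto simp: algebra_simps)
    moreover have "m \<noteq> y"
      using xy non by (auto simp: algebra_simps)
    ultimately have "a * m - n \<noteq> b"
      using * by auto
    moreover have "t = m * g a b - c + (b - (a * m - n)) *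
        ((g (a + (x - a)) (m * (x - a) + (a * m - n)) - g a b) / (x - a))"
    proof -
      have 1: "m * (x - a) + (a * m - n) = x * y - (a * y - b)" "a + (x - a) = x"
        unfolding xy(1) by (simp_all add: algebra_simps)
      show ?thesis
        unfolding * 1 xy(2) using \<open>x \<noteq> a\<close> by (simp add: field_simps)
    qed
    ultimately show ?R
      using \<open>x \<noteq> a\<close> by (metis right_minus_eq)
  next
    assume ?R
    then obtain s where s: "s \<noteq> 0" and n: "a * m - n \<noteq> b"
      and t: "t = m * g a b - c +
        (b - (a * m - n)) * ((g (a + s) (m * s + (a * m - n)) - g a b) / s)"
      by blast
    define x where "x = a + s"
    define y where "y = m - (b - (a * m - n)) / s"
    have x: "m * s + (a * m - n) = x * y - (a * y - b)"
      using s by (simp add: x_def y_def field_simps)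
    have "n = x * m - (x * y - (a * y - b))"
      unfolding x[symmetric] by (simp add: x_def algebra_simps)
    moreover have "t = m * g x (x * y - (a * y - b)) -
        (y * g x (x * y - (a * y - b)) - (y * g a b - c))"
      unfolding t x x_def[symmetric] using s by (simp add: y_def field_simps)
    moreover have "n \<noteq> a * m - b"
      using n by auto
    ultimately show ?L
      by blast
  qed
  finally show ?thesis .
qed

text \<open>The line of slope \<open>m\<close> is given by its height \<open>e\<close> above the
  abscissa \<open>a\<close> instead of an intercept. Then \<open>s\<close> is the horizontal
  displacement from \<open>(a, b)\<close>, and this point lies off the line iff
  \<open>e \<noteq> b\<close>.\<close>

definition slopes :: "'a::{field,finite} \<Rightarrow> 'a \<Rightarrow> 'a \<Rightarrow> 'a \<Rightarrow> nat" where
  "slopes a b m e = card ((\<lambda>s. (g (a + s) (m * s + e) - g a b) / s) ` (- {0}))"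

lemma card_affine_image:
  fixes f :: "'b \<Rightarrow> 'a::field"
  assumes "d \<noteq> 0"
  shows "card {t. \<exists>s. s \<noteq> u \<and> t = c + d * f s} = card (f ` (- {u}))"
proof -
  have "{t. \<exists>s. s \<noteq> u \<and> t = c + d * f s} = (\<lambda>x. c + d * x) ` f ` (- {u})"
    by auto
  moreover have "inj_on (\<lambda>x. c + d * x) (f ` (- {u}))"
    using assms by (auto intro: inj_onI)
  ultimately show ?thesis
    by (simp only: card_image)
qed

text \<open>For fixed \<open>(z, w)\<close> the admissible \<open>t\<close> are the image of the
  slope set under an affine map with factor \<open>w - (A * z - B)\<close>. The factor is nonzero on
  the range of summation, and the omitted \<open>w\<close> admits no \<open>t\<close>.\<close>

lemma r3_Line:
  fixes A B C :: "'a::{field,finite}"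
  shows "r\<^sub>3 (Line A B C) = (\<Sum>z\<in>UNIV. \<Sum>w\<in>- {A * z - B}. slopes z w A (A * z - B))"
proof -
  define T where "T z w = {t. graph_dist R_adj (Line A B C) (Point z w t) = 3}" for z w
  have no_line: "graph_dist R_adj (Line A B C) (Line x y z) \<noteq> 3" for x y z
    unfolding graph_dist_R_adj_3_iff vertex_ex_iff by simp
  have "{v. graph_dist R_adj (Line A B C) v = 3} =
      (\<lambda>(z, w, t). Point z w t) ` (SIGMA z:UNIV. SIGMA w:UNIV. T z w)" (is "?D = ?P ` ?S")
  proof -
    have "v \<in> ?D \<longleftrightarrow> v \<in> ?P ` ?S" for v
      by (cases v) (auto simp: T_def no_line image_iff)
    then show ?thesis
      by blast
  qed
  then have "r\<^sub>3 (Line A B C) = card ?S"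
    unfolding r\<^sub>3_def by (simp add: card_image inj_on_def split_def prod_eq_iff)
  also have "\<dots> = (\<Sum>z\<in>UNIV. \<Sum>w\<in>UNIV. card (T z w))"
    by simp
  also have "\<dots> = (\<Sum>z\<in>UNIV. \<Sum>w\<in>- {A * z - B}. card (T z w))"
    by (intro sum.cong[OF refl] sum.mono_neutral_right) (auto simp: T_def dist_3_Line_iff)
  also have "\<dots> = (\<Sum>z\<in>UNIV. \<Sum>w\<in>- {A * z - B}. slopes z w A (A * z - B))"
  proof (intro sum.cong[OF refl])
    fix z w :: 'a
    assume "w \<in> - {A * z - B}"
    then have "w \<noteq> A * z - B" "w - (A * z - B) \<noteq> 0"
      by auto
    then show "card (T z w) = slopes z w A (A * z - B)"
      unfolding T_def dist_3_Line_iff slopes_def by (simp only: card_affine_image simp_thms not_False_eq_True)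
  qed
  finally show ?thesis .
qed

lemma r3_Point:
  fixes a b c :: "'a::{field,finite}"
  shows "r\<^sub>3 (Point a b c) = (\<Sum>m\<in>UNIV. \<Sum>e\<in>- {b}. slopes a b m e)"
proof -
  \<comment> \<open>For fixed \<open>m\<close> the substitution \<open>n = a * m - e\<close> is a
    bijection, and \<open>e\<close> is the height of the line \<open>v = m * x - n\<close> at
    \<open>a\<close>.\<close>
  define T where "T m e = {t. graph_dist R_adj (Point a b c) (Line m (a * m - e) t) = 3}" for m e
  have no_point: "graph_dist R_adj (Point a b c) (Point x y z) \<noteq> 3" for x y z
    unfolding graph_dist_R_adj_3_iff vertex_ex_iff by simp
  have "{v. graph_dist R_adj (Point a b c) v = 3} =
      (\<lambda>(m, e, t). Line m (a * m - e) t) ` (SIGMA m:UNIV. SIGMA e:UNIV. T m e)" (is "?D = ?P ` ?S")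
  proof -
    have "v \<in> ?D \<longleftrightarrow> v \<in> ?P ` ?S" for v
    proof (cases v)
      case (Line m n t)
      then show ?thesis
        by (auto simp: T_def image_iff intro!: exI[of _ "a * m - n"])
    qed (auto simp: no_point)
    then show ?thesis
      by blast
  qed
  then have "r\<^sub>3 (Point a b c) = card ?S"
    unfolding r\<^sub>3_def by (simp add: card_image inj_on_def split_def prod_eq_iff)
  also have "\<dots> = (\<Sum>m\<in>UNIV. \<Sum>e\<in>UNIV. card (T m e))"
    by simp
  also have "\<dots> = (\<Sum>m\<in>UNIV. \<Sum>e\<in>- {b}. card (T m e))"
    by (intro sum.cong[OF refl] sum.mono_neutral_right) (auto simp: T_def dist_3_Point_iff)
  also have "\<dots> = (\<Sum>m\<in>UNIV. \<Sum>e\<in>- {b}. slopes a b m e)"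
  proof (intro sum.cong[OF refl])
    fix m e :: 'a
    assume e: "e \<in> - {b}"
    have "a * m - (a * m - e) = e"
      by simp
    moreover from e have "e \<noteq> b" "b - e \<noteq> 0"
      by auto
    ultimately show "card (T m e) = slopes a b m e"
      unfolding T_def dist_3_Point_iff slopes_def by (simp only: card_affine_image simp_thms not_False_eq_True)
  qed
  finally show ?thesis .
qed

section \<open>Power sums over a finite field\<close>

text \<open>Translation by 1 permutes the field, so adding 1 to every summand leaves the total
  unchanged.\<close>

lemma of_nat_CARD_eq_0: "of_nat CARD('a::{field,finite}) = (0 :: 'a)"
proof -
  have "(\<Sum>x\<in>UNIV. x + 1) = (\<Sum>x\<in>(UNIV :: 'a set). x)"
    by (rule sum.reindex_bij_witness[of _ "\<lambda>x. x - 1" "\<lambda>x. x + 1"]) auto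
  then show ?thesis
    by (simp add: sum.distrib)
qed

lemma card_nonzero: "card (- {0 :: 'a::{zero,finite}}) = CARD('a) - 1"
  by (simp add: Compl_eq_Diff_UNIV card_Diff_subset)

lemma power_CARD_minus_1:
  fixes x :: "'a::{field,finite}"
  assumes "x \<noteq> 0"
  shows "x ^ (CARD('a) - 1) = 1"
proof -
  have "(\<Prod>y\<in>- {0}. x * y) = (\<Prod>y\<in>- {0 :: 'a}. y)"
    using assms by (intro prod.reindex_bij_witness[of _ "\<lambda>y. y / x" "\<lambda>y. x * y"]) auto
  then have "x ^ (CARD('a) - 1) * (\<Prod>y\<in>- {0 :: 'a}. y) = 1 * (\<Prod>y\<in>- {0 :: 'a}. y)"
    by (simp add: prod.distrib card_nonzero)
  moreover have "(\<Prod>y\<in>- {0 :: 'a}. y) \<noteq> 0"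
    by simp
  ultimately show ?thesis
    by (metis mult_right_cancel)
qed

text \<open>If \<open>q - 1\<close> divides \<open>n\<close>, all \<open>q - 1\<close> summands are
  1. Otherwise reduce \<open>n\<close> to \<open>r < q - 1\<close>: the polynomial
  \<open>x^r - 1\<close> has too few roots to vanish at every nonzero element, so some
  \<open>c\<close> has \<open>c^r \<noteq> 1\<close>; scaling by \<open>c\<close> multiplies the sum
  by \<open>c^r\<close>, which forces it to be 0.\<close>

lemma sum_powers_nonzero:
  fixes n :: nat
  shows "(\<Sum>x\<in>- {0 :: 'a::{field,finite}}. x ^ n) = (if CARD('a) - 1 dvd n then -1 else 0)"
proof (cases "CARD('a) - 1 dvd n")
  case True
  then obtain k where k: "n = (CARD('a) - 1) * k" ..
  have "(\<Sum>x\<in>- {0 :: 'a}. x ^ n) = (\<Sum>x\<in>- {0 :: 'a}. 1)"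
    by (intro sum.cong) (auto simp: k power_mult power_CARD_minus_1 simp del: One_nat_def)
  also have "\<dots> = of_nat CARD('a) - 1"
    by (simp add: card_nonzero of_nat_diff)
  finally show ?thesis
    using True by (simp add: of_nat_CARD_eq_0)
next
  case False
  define r where "r = n mod (CARD('a) - 1)"
  have "card {0, 1 :: 'a} \<le> CARD('a)"
    by (intro card_mono) auto
  then have "0 < CARD('a) - 1"
    by simp
  with False have r: "0 < r" "r < CARD('a) - 1"
    unfolding r_def by (auto simp: dvd_eq_mod_eq_0)
  have pow: "x ^ n = x ^ r" if "x \<noteq> 0" for x :: 'a
  proof -
    have "x ^ n = x ^ ((CARD('a) - 1) * (n div (CARD('a) - 1)) + r)"
      by (simp add: r_def)
    then show ?thesis
      using that by (simp only: power_add power_mult power_CARD_minus_1 power_one mult_1_left not_False_eq_True)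
  qed
  have "\<exists>c :: 'a. c \<noteq> 0 \<and> c ^ r \<noteq> 1"
  proof (rule ccontr)
    assume "\<not> ?thesis"
    then have *: "c ^ r = 1" if "c \<noteq> 0" for c :: 'a
      using that by blast
    let ?p = "monom 1 r - 1 :: 'a poly"
    have deg: "degree ?p \<le> r"
      by (intro degree_diff_le) (auto simp: degree_monom_eq)
    have "coeff ?p r = 1"
      using r by simp
    then have "?p \<noteq> 0"
      by (metis coeff_0 zero_neq_one)
    then have "card {x. poly ?p x = 0} \<le> r"
      using deg card_poly_roots_bound[of ?p] by linarith
    moreover have "- {0} \<subseteq> {x. poly ?p x = 0}"
      using * by (auto simp: poly_monom)
    then have "CARD('a) - 1 \<le> card {x. poly ?p x = 0}"
      unfolding card_nonzero[symmetric] by (intro card_mono) auto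
    ultimately show False
      using r by linarith
  qed
  then obtain c :: 'a where c: "c \<noteq> 0" "c ^ r \<noteq> 1"
    by blast
  have "(\<Sum>x\<in>- {0 :: 'a}. x ^ r) = (\<Sum>x\<in>- {0 :: 'a}. (c * x) ^ r)"
    using c by (intro sum.reindex_bij_witness[of _ "\<lambda>y. c * y" "\<lambda>y. y / c"]) auto
  also have "\<dots> = c ^ r * (\<Sum>x\<in>- {0 :: 'a}. x ^ r)"
    by (simp add: power_mult_distrib sum_distrib_left)
  finally have "(\<Sum>x\<in>- {0 :: 'a}. x ^ r) = 0"
    using c by simp
  moreover have "(\<Sum>x\<in>- {0 :: 'a}. x ^ n) = (\<Sum>x\<in>- {0 :: 'a}. x ^ r)"
    by (intro sum.cong) (auto simp: pow)
  ultimately show ?thesis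
    using False by simp
qed

lemma sum_powers_UNIV:
  assumes "0 < n" "n < CARD('a) - 1"
  shows "(\<Sum>x\<in>(UNIV :: 'a::{field,finite} set). x ^ n) = 0"
proof -
  have "(\<Sum>x\<in>(UNIV :: 'a set). x ^ n) = (\<Sum>x\<in>- {0 :: 'a}. x ^ n)"
    using assms by (intro sum.mono_neutral_right) auto
  then show ?thesis
    using assms by (auto simp: sum_powers_nonzero dest: dvd_imp_le)
qed

text \<open>The sum over nonzero arguments extracts the constant term of the Laurent polynomial
  \<open>(P(s) / s)\<^sup>k\<close>, provided that no other multiple of \<open>q - 1\<close> occurs as an exponent.\<close>
lemma sum_power_poly_div:
  fixes P :: "'a::{field,finite} poly"
  assumes "degree P \<le> 4" "3 * k < CARD('a) - 1"
  shows "(\<Sum>s\<in>- {0}. (poly P s / s) ^ k) = - coeff (P ^ k) k"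
proof -
  define q where "q = CARD('a)"
  have k: "3 * k < q - 1" "k < q - 1"
    using assms by (auto simp: q_def)
  have deg: "degree (P ^ k) \<le> 4 * k"
    using assms(1) degree_power_le[of P k] by (meson le_trans mult_le_mono1)
  \<comment> \<open>The negative power of \<open>s\<close> is replaced by
    \<open>s ^ (q - 1 - k)\<close>, so that only natural exponents occur.\<close>
  have "(poly P s / s) ^ k = (\<Sum>i\<le>4 * k. coeff (P ^ k) i * s ^ (q - 1 - k + i))"
    if "s \<in> - {0}" for s
  proof -
    have "s ^ (q - 1 - k) * s ^ k = 1"
      using k that by (simp add: q_def power_CARD_minus_1 flip: power_add del: One_nat_def)
    then have "1 / s ^ k = s ^ (q - 1 - k)"
      using that by (simp add: field_simps)
    then have "(poly P s / s) ^ k = poly (P ^ k) s * s ^ (q - 1 - k)"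
      by (metis poly_power power_divide mult.right_neutral times_divide_eq_right)
    also have "poly (P ^ k) s = (\<Sum>i\<le>4 * k. coeff (P ^ k) i * s ^ i)"
      unfolding poly_altdef using deg
      by (intro sum.mono_neutral_left) (auto simp: coeff_eq_0)
    finally show ?thesis
      by (simp add: sum_distrib_left power_add mult_ac)
  qed
  then have "(\<Sum>s\<in>- {0}. (poly P s / s) ^ k) =
      (\<Sum>s\<in>- {0}. \<Sum>i\<le>4 * k. coeff (P ^ k) i * s ^ (q - 1 - k + i))"
    by (intro sum.cong) auto
  also have "\<dots> = (\<Sum>i\<le>4 * k. coeff (P ^ k) i * (\<Sum>s\<in>- {0}. s ^ (q - 1 - k + i)))"
    by (subst sum.swap) (simp add: sum_distrib_left)
  also have "\<dots> = (\<Sum>i\<le>4 * k. if i = k then - coeff (P ^ k) i else 0)"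
  proof (intro sum.cong refl)
    fix i
    assume "i \<in> {..4 * k}"
    \<comment> \<open>Since \<open>i \<le> 4 * k\<close> and \<open>3 * k < q - 1\<close>, the
      exponent lies strictly between 0 and \<open>2 * (q - 1)\<close>; the only multiple of
      \<open>q - 1\<close> there is \<open>q - 1\<close> itself, reached at
      \<open>i = k\<close>.\<close>
    then have i: "0 < q - 1 - k + i" "q - 1 - k + i < 2 * (q - 1)"
      using k by auto
    have "q - 1 dvd q - 1 - k + i \<longleftrightarrow> i = k"
    proof
      assume "q - 1 dvd q - 1 - k + i"
      then obtain j where j: "q - 1 - k + i = (q - 1) * j" ..
      with i have "(q - 1) * j < (q - 1) * 2"
        by simp
      then have "j < 2"
        by (simp only: mult_less_cancel1)
      moreover have "j \<noteq> 0"
        using i(1) j by (intro notI) simp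
      ultimately have "j = 1"
        by simp
      with j k show "i = k"
        by simp
    qed (use k in simp)
    then show "coeff (P ^ k) i * (\<Sum>s\<in>- {0}. s ^ (q - 1 - k + i)) =
        (if i = k then - coeff (P ^ k) i else 0)"
      by (simp add: sum_powers_nonzero flip: q_def)
  qed
  also have "\<dots> = - coeff (P ^ k) k"
    by simp
  finally show ?thesis .
qed

text \<open>If at most one value is lost, the value multiset of \<open>h\<close> is the whole field with one element
  \<open>v\<close> added and two elements removed.\<close>
lemma sum_image_deficient:
  fixes h :: "'a::{field,finite} \<Rightarrow> 'a"
  assumes "CARD('a) \<ge> 3" and "CARD('a) - 3 < card (h ` (- {0}))"
  obtains v m1 m2 where
    "\<And>\<phi> :: 'a \<Rightarrow> 'a. (\<Sum>s\<in>- {0}. \<phi> (h s)) = (\<Sum>t\<in>UNIV. \<phi> t) + \<phi> v - \<phi> m1 - \<phi> m2"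
proof -
  define I where "I = h ` (- {0})"
  \<comment> \<open>\<open>S\<close> contains one preimage of each value; the at most one argument
    outside it accounts for the repeated value.\<close>
  obtain S where S: "S \<subseteq> - {0}" "inj_on h S" "I = h ` S"
    using subset_image_inj[of I h "- {0}"] by (auto simp: I_def)
  have cS: "card S = card I"
    using S by (simp add: card_image)
  have split: "(\<Sum>s\<in>- {0}. \<phi> (h s)) =
      (\<Sum>t\<in>UNIV. \<phi> t) + (\<Sum>s\<in>- {0} - S. \<phi> (h s)) - (\<Sum>t\<in>- I. \<phi> t)" for \<phi> :: "'a \<Rightarrow> 'a"
  proof -
    have "(\<Sum>s\<in>- {0}. \<phi> (h s)) = (\<Sum>s\<in>- {0} - S. \<phi> (h s)) + (\<Sum>s\<in>S. \<phi> (h s))"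
      using S by (intro sum.subset_diff) auto
    moreover have "(\<Sum>s\<in>S. \<phi> (h s)) = (\<Sum>t\<in>I. \<phi> t)"
      using S by (simp add: sum.reindex)
    moreover have "(\<Sum>t\<in>UNIV. \<phi> t) = (\<Sum>t\<in>UNIV - I. \<phi> t) + (\<Sum>t\<in>I. \<phi> t)"
      by (intro sum.subset_diff) auto
    ultimately show ?thesis
      by (simp add: Compl_eq_Diff_UNIV)
  qed
  have le: "card I \<le> CARD('a) - 1"
    unfolding I_def card_nonzero[symmetric] by (intro card_image_le) auto
  have cD: "card (- {0} - S) = CARD('a) - 1 - card I"
    using S cS by (subst card_Diff_subset) (auto simp: card_nonzero)
  have cI: "card (- I) = CARD('a) - card I"
    by (simp add: Compl_eq_Diff_UNIV card_Diff_subset)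
  consider "card I = CARD('a) - 1" | "card I = CARD('a) - 2"
    using assms le unfolding I_def by linarith
  then show thesis
  proof cases
    case 1
    then have D: "- {0} - S = {}"
      using cD by simp
    from 1 assms have "card (- I) = 1"
      using cI by simp
    then obtain m where m: "- I = {m}"
      using card_1_singletonE by blast
    \<comment> \<open>Here \<open>h\<close> is injective and omits only \<open>m\<close>. Taking all
      three elements equal to \<open>m\<close> gives a net loss of one \<open>m\<close>.\<close>
    show thesis
      using that[of m m m] unfolding split D m by simp
  next
    case 2
    then have "card (- {0} - S) = 1"
      using cD assms by simp
    then obtain s where s: "- {0} - S = {s}"
      using card_1_singletonE by blast
    from 2 assms have "card (- I) = 2"
      using cI by simp
    then obtain m1 m2 where m: "- I = {m1, m2}" "m1 \<noteq> m2"
      by (auto simp: card_2_iff)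
    show thesis
      using that[of "h s" m1 m2] m(2) unfolding split s m(1) by (simp add: algebra_simps)
  qed
qed

section \<open>Values of Laurent polynomials with a triple and a simple pole\<close>

text \<open>These identities express power sums through \<open>a + b\<close> and
  \<open>a * b\<close>. They are applied to the omitted values \<open>m1\<close>, \<open>m2\<close>,
  whose sum is \<open>v\<close> by the first moment and whose product is given by the
  second.\<close>

lemma power_sum_4:
  fixes a b :: "'a::idom"
  shows "(a + b) ^ 4 - a ^ 4 - b ^ 4 = 4 * (a * b) * (a + b)^2 - 2 * (a * b)^2"
  by algebra

lemma power_sum_5:
  fixes a b :: "'a::idom"
  shows "(a + b) ^ 5 - a ^ 5 - b ^ 5 = 5 * (a * b) * (a + b)^3 - 5 * (a * b)^2 * (a + b)"
  by algebra

lemma power_sum_6: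
  fixes a b :: "'a::idom"
  shows "(a + b) ^ 6 - a ^ 6 - b ^ 6 =
    6 * (a * b) * (a + b)^4 - 9 * (a * b)^2 * (a + b)^2 + 2 * (a * b)^3"
  by algebra

lemma power_sum_7:
  fixes a b :: "'a::idom"
  shows "(a + b) ^ 7 - a ^ 7 - b ^ 7 =
    7 * (a * b) * (a + b)^5 - 14 * (a * b)^2 * (a + b)^3 + 7 * (a * b)^3 * (a + b)"
  by algebra

lemma power_sum_8:
  fixes a b :: "'a::idom"
  shows "(a + b) ^ 8 - a ^ 8 - b ^ 8 =
    8 * (a * b) * (a + b)^6 - 20 * (a * b)^2 * (a + b)^4 + 16 * (a * b)^3 * (a + b)^2 - 2 * (a * b)^4"
  by algebra

text \<open>The coefficient of \<open>s^k\<close> in \<open>P^k\<close> is the constant term of the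
  \<open>k\<close>-th power of \<open>P(s) / s\<close>, a Laurent polynomial with a simple pole at 0
  and a triple pole at infinity.\<close>

lemma coeff_powers:
  fixes \<alpha> \<beta> \<kappa> :: "'a::idom"
  defines "P \<equiv> [:1, 0, \<kappa>, \<beta>, \<alpha>:]"
  shows "coeff (P ^ 1) 1 = 0" "coeff (P ^ 2) 2 = 2 * \<kappa>" "coeff (P ^ 3) 3 = 3 * \<beta>"
    "coeff (P ^ 4) 4 = 4 * \<alpha> + 6 * \<kappa>^2" "coeff (P ^ 5) 5 = 20 * \<beta> * \<kappa>"
    "coeff (P ^ 6) 6 = 20 * \<kappa>^3 + 30 * \<alpha> * \<kappa> + 15 * \<beta>^2"
    "coeff (P ^ 7) 7 = 105 * \<beta> * \<kappa>^2 + 42 * \<alpha> * \<beta>"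
    "coeff (P ^ 8) 8 = 70 * \<kappa>^4 + 168 * \<alpha> * \<kappa>^2 + 168 * \<beta>^2 * \<kappa> + 28 * \<alpha>^2"
proof -
  have P2: "P ^ 2 = [:1, 0, 2 * \<kappa>, 2 * \<beta>, 2 * \<alpha> + \<kappa>^2, 2 * \<beta> * \<kappa>, 2 * \<alpha> * \<kappa> + \<beta>^2,
      2 * \<alpha> * \<beta>, \<alpha>^2:]"
    by (simp add: P_def power2_eq_square algebra_simps)
  have P4: "P ^ 4 = P ^ 2 * P ^ 2" and P3: "P ^ 3 = P ^ 2 * P" and P5: "P ^ 5 = P ^ 4 * P"
    and P6: "P ^ 6 = P ^ 4 * P ^ 2" and P7: "P ^ 7 = P ^ 4 * P ^ 3" and P8: "P ^ 8 = P ^ 4 * P ^ 4"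
    by (simp_all flip: power_add power_Suc2)
  show "coeff (P ^ 1) 1 = 0" "coeff (P ^ 2) 2 = 2 * \<kappa>"
    unfolding P2 by (simp_all add: P_def numeral_2_eq_2)
  have c: "coeff P 0 = 1" "coeff P 1 = 0" "coeff P 2 = \<kappa>" "coeff P 3 = \<beta>"
    "coeff P 4 = \<alpha>" "coeff P 5 = 0" "coeff P 6 = 0" "coeff P 7 = 0" "coeff P 8 = 0"
    by (simp_all add: P_def numeral_eq_Suc)
  have c2: "coeff (P^2) 0 = 1" "coeff (P^2) 1 = 0" "coeff (P^2) 2 = 2*\<kappa>"
    "coeff (P^2) 3 = 2*\<beta>" "coeff (P^2) 4 = 2 * \<alpha> + \<kappa>^2"
    "coeff (P^2) 5 = 2 * \<beta> * \<kappa>" "coeff (P^2) 6 = 2 * \<alpha> * \<kappa> + \<beta>^2"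
    "coeff (P^2) 7 = 2*\<alpha> * \<beta>" "coeff (P^2) 8 = \<alpha>^2"
    unfolding P2 by (simp_all add: numeral_eq_Suc)
  have up: "{..0::nat} = {0}" "{..1::nat} = {0, 1}" "{..2::nat} = {0, 1, 2}"
    "{..3::nat} = {0, 1, 2, 3}" "{..4::nat} = {0, 1, 2, 3, 4}" "{..5::nat} = {0, 1, 2, 3, 4, 5}"
    "{..6::nat} = {0, 1, 2, 3, 4, 5, 6}" "{..7::nat} = {0, 1, 2, 3, 4, 5, 6, 7}"
    "{..8::nat} = {0, 1, 2, 3, 4, 5, 6, 7, 8}"
    by auto
  have c3: "coeff (P^3) 0 = 1" "coeff (P^3) 1 = 0" "coeff (P^3) 2 = 3*\<kappa>"
    "coeff (P^3) 3 = 3*\<beta>" "coeff (P^3) 4 = 3 * \<alpha> + 3 * \<kappa>^2"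
    "coeff (P^3) 5 = 6 * \<beta> * \<kappa>"
    "coeff (P^3) 6 = 6 * \<alpha> * \<kappa> + 3 * \<beta>^2 + \<kappa>^3"
    "coeff (P^3) 7 = 6 * \<alpha> * \<beta> + 3 * \<beta> * \<kappa>^2"
    unfolding P3 coeff_mult up by (simp_all add: c c2 c[simplified] c2[simplified]) (algebra+)?
  have c4: "coeff (P^4) 0 = 1" "coeff (P^4) 1 = 0" "coeff (P^4) 2 = 4*\<kappa>"
    "coeff (P^4) 3 = 4*\<beta>" "coeff (P^4) 4 = 4 * \<alpha> + 6 * \<kappa>^2"
    "coeff (P^4) 5 = 12 * \<beta> * \<kappa>"
    "coeff (P^4) 6 = 12 * \<alpha> * \<kappa> + 6 * \<beta>^2 + 4 * \<kappa>^3"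
    "coeff (P^4) 7 = 12 * \<alpha> * \<beta> + 12 * \<beta> * \<kappa>^2"
    "coeff (P^4) 8 = 6 * \<alpha>^2 + 12 * \<alpha> * \<kappa>^2 + 12 * \<beta>^2 * \<kappa> + \<kappa>^4"
    unfolding P4 coeff_mult up by (simp_all add: c c2 c[simplified] c2[simplified]) (algebra+)?
  show "coeff (P ^ 3) 3 = 3 * \<beta>" "coeff (P ^ 4) 4 = 4 * \<alpha> + 6 * \<kappa>^2"
    by (fact c3 c4)+
  show "coeff (P ^ 5) 5 = 20 * \<beta> * \<kappa>"
    unfolding P5 coeff_mult up by (simp add: c c4 c[simplified] c4[simplified], algebra?)
  show "coeff (P ^ 6) 6 = 20 * \<kappa>^3 + 30 * \<alpha> * \<kappa> + 15 * \<beta>^2"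
    unfolding P6 coeff_mult up by (simp add: c2 c4 c2[simplified] c4[simplified], algebra?)
  show "coeff (P ^ 7) 7 = 105 * \<beta> * \<kappa>^2 + 42 * \<alpha> * \<beta>"
    unfolding P7 coeff_mult up by (simp add: c3 c4 c3[simplified] c4[simplified], algebra?)
  show "coeff (P ^ 8) 8 = 70 * \<kappa>^4 + 168 * \<alpha> * \<kappa>^2 + 168 * \<beta>^2 * \<kappa> + 28 * \<alpha>^2"
    unfolding P8 coeff_mult up by (simp add: c4 c4[simplified], algebra?)
qed

lemma two_neq_0_if_odd_CARD:
  assumes "odd CARD('a)"
  shows "(2 :: 'a::{field,finite}) \<noteq> 0"
proof
  assume 2: "(2 :: 'a) = 0"
  from assms obtain k where "CARD('a) = 2 * k + 1"
    by (auto elim: oddE)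
  then have "of_nat CARD('a) = (2 :: 'a) * of_nat k + 1"
    by simp
  then show False
    using 2 by (simp add: of_nat_CARD_eq_0)
qed

lemma three_neq_0_if_CARD_mod_3:
  assumes "CARD('a) mod 3 = 1"
  shows "(3 :: 'a::{field,finite}) \<noteq> 0"
proof
  assume 3: "(3 :: 'a) = 0"
  have "CARD('a) = 3 * (CARD('a) div 3) + 1"
    using assms by presburger
  then have "of_nat CARD('a) = (of_nat (3 * (CARD('a) div 3) + 1) :: 'a)"
    by (rule arg_cong)
  then have "of_nat CARD('a) = (3 :: 'a) * of_nat (CARD('a) div 3) + 1"
    by simp
  then show False
    using 3 by (simp add: of_nat_CARD_eq_0)
qed

text \<open>Power sums over the whole field vanish for these exponents, so only the three
  exceptional elements contribute.\<close>

lemma deficient_moments: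
  fixes h :: "'a::{field,finite} \<Rightarrow> 'a"
  assumes "CARD('a) \<ge> 3" and "CARD('a) - 3 < card (h ` (- {0}))"
  obtains v m1 m2 :: 'a where
    "\<And>k. 0 < k \<Longrightarrow> k < CARD('a) - 1 \<Longrightarrow> (\<Sum>s\<in>- {0}. h s ^ k) = v ^ k - m1 ^ k - m2 ^ k"
proof -
  obtain v m1 m2 where *: "\<And>\<phi> :: 'a \<Rightarrow> 'a. (\<Sum>s\<in>- {0}. \<phi> (h s)) =
      (\<Sum>t\<in>UNIV. \<phi> t) + \<phi> v - \<phi> m1 - \<phi> m2"
    using sum_image_deficient[of h] assms by auto
  have "(\<Sum>s\<in>- {0}. h s ^ k) = v ^ k - m1 ^ k - m2 ^ k"
    if "0 < k" "k < CARD('a) - 1" for k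
    using *[of "\<lambda>x. x ^ k"] sum_powers_UNIV[OF that] by simp
  then show thesis
    using that by blast
qed

text \<open>The moment formula is valid for \<open>3 * k < q - 1\<close>. From \<open>q = 25\<close>
  on this covers \<open>k \<le> 7\<close>, and \<open>k = 8\<close> once \<open>q > 25\<close>; the
  distinction of characteristic 5 bridges this gap.\<close>

lemma card_image_simple_pole:
  fixes \<alpha> \<beta> \<kappa> :: "'a::{field,finite}"
  assumes "odd CARD('a)" "CARD('a) mod 3 = 1" "CARD('a) \<ge> 25" "\<alpha> \<noteq> 0"
  shows "card ((\<lambda>s. \<alpha> * s^3 + \<beta> * s^2 + \<kappa> * s + 1 / s) ` (- {0})) \<le> CARD('a) - 3"
proof (rule ccontr)
  define P where "P = [:1, 0, \<kappa>, \<beta>, \<alpha>:]"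
  assume "\<not> ?thesis"
  moreover have "(\<lambda>s. \<alpha> * s^3 + \<beta> * s^2 + \<kappa> * s + 1 / s) ` (- {0}) = (\<lambda>s. poly P s / s) ` (- {0})"
    by (intro image_cong) (auto simp: P_def field_simps power2_eq_square power3_eq_cube)
  ultimately have deficient: "CARD('a) - 3 < card ((\<lambda>s. poly P s / s) ` (- {0}))"
    by simp
  have P: "degree P \<le> 4" "CARD('a) \<ge> 3"
    using assms(3) by (simp_all add: P_def)
  obtain v m1 m2 where M': "\<And>k. 0 < k \<Longrightarrow> k < CARD('a) - 1 \<Longrightarrow>
      (\<Sum>s\<in>- {0}. (poly P s / s) ^ k) = v ^ k - m1 ^ k - m2 ^ k"
    using deficient_moments[OF P(2) deficient] by blast
  have M: "v ^ k - m1 ^ k - m2 ^ k = - coeff (P ^ k) k" if "0 < k" "3 * k < CARD('a) - 1" for k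
    using M'[of k] that sum_power_poly_div[OF P(1) that(2)] by simp
  note cp = coeff_powers[where \<alpha> = \<alpha> and \<beta> = \<beta> and \<kappa> = \<kappa>, folded P_def]
  have two: "(2 :: 'a) \<noteq> 0"
    using assms(1) by (rule two_neq_0_if_odd_CARD)
  have three: "(3 :: 'a) \<noteq> 0"
    using assms(2) by (rule three_neq_0_if_CARD_mod_3)
  have v: "v = m1 + m2"
    using M[of 1] assms(3) cp(1) by (simp add: algebra_simps)
  txt \<open>The moments up to 4 express \<open>m1 m2\<close>, \<open>\<beta>\<close> and \<open>\<alpha>\<close> through \<open>v\<close> and \<open>\<kappa>\<close>; the higher ones are then
    incompatible polynomial equations in \<open>v\<^sup>2 / \<kappa>\<close>.\<close>
  have "v^2 - m1^2 - m2^2 = - (2 * \<kappa>)"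
    using M[of 2] assms(3) cp(2) by simp
  then have "2 * (m1 * m2) = 2 * (- \<kappa>)"
    unfolding v by algebra
  then have e: "m1 * m2 = - \<kappa>"
    by (rule mult_left_cancel[OF two, THEN iffD1])
  have "v^3 - m1^3 - m2^3 = - (3 * \<beta>)"
    using M[of 3] assms(3) cp(3) by simp
  then have "3 * \<beta> = 3 * (\<kappa> * v)"
    using e unfolding v by algebra
  then have \<beta>: "\<beta> = \<kappa> * v"
    by (rule mult_left_cancel[OF three, THEN iffD1])
  have "4 * (- \<kappa>) * v^2 - 2 * (- \<kappa>)^2 = - (4 * \<alpha> + 6 * \<kappa>^2)"
    using M[of 4] assms(3) power_sum_4[of m1 m2] cp(4) unfolding e v[symmetric] by simp
  then have "2 * (2 * \<alpha>) = 2 * (2 * (\<kappa> * v^2 - \<kappa>^2))"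
    by algebra
  then have \<alpha>: "\<alpha> = \<kappa> * v^2 - \<kappa>^2"
    using two by (metis mult_left_cancel)
  with assms(4) have \<kappa>: "\<kappa> \<noteq> 0"
    by auto
  have "6 * (- \<kappa>) * v^4 - 9 * (- \<kappa>)^2 * v^2 + 2 * (- \<kappa>)^3 = - (20 * \<kappa>^3 + 30 * \<alpha> * \<kappa> + 15 * \<beta>^2)"
    using M[of 6] assms(3) power_sum_6[of m1 m2] cp(6) unfolding e v[symmetric] by simp
  then have "2 * 3 * \<kappa> * (v^4 - 6 * \<kappa> * v^2 + 2 * \<kappa>^2) = 0"
    unfolding \<alpha> \<beta> by algebra
  then have M6: "v^4 - 6 * \<kappa> * v^2 + 2 * \<kappa>^2 = 0"
    using two three \<kappa> by (simp only: mult_eq_0_iff) blast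
  have v0: "v \<noteq> 0"
    using M6 two \<kappa> by auto
  show False
  proof (cases "(5 :: 'a) = 0")
    \<comment> \<open>In characteristic 5 the fifth moment carries no information, so the seventh is
      compared with the sixth. Its factor 7 equals 2 and can be cancelled.\<close>
    case True
    have "7 * (- \<kappa>) * v^5 - 14 * (- \<kappa>)^2 * v^3 + 7 * (- \<kappa>)^3 * v =
        - (105 * \<beta> * \<kappa>^2 + 42 * \<alpha> * \<beta>)"
      using M[of 7] assms(3) power_sum_7[of m1 m2] cp(7) unfolding e v[symmetric] by simp
    then have "7 * \<kappa> * v * (v^4 - 4 * \<kappa> * v^2 - 8 * \<kappa>^2) = 0"
      unfolding \<alpha> \<beta> by algebra
    moreover have "(7 :: 'a) = 5 + 2"
      by simp
    then have "(7 :: 'a) = 2"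
      by (simp only: True add_0)
    ultimately have "v^4 - 4 * \<kappa> * v^2 - 8 * \<kappa>^2 = 0"
      using two \<kappa> v0 by simp
    with M6 have "2 * \<kappa> * v^2 = 5 * (2 * \<kappa>^2)"
      by algebra
    then show False
      using True two \<kappa> v0 by simp
  next
    case False
    \<comment> \<open>A field with 25 elements would have \<open>5 = 0\<close>. The order is 1
      modulo 6, so the next possibility is 31, where the eighth moment is available.\<close>
    have "CARD('a) \<noteq> 25"
    proof
      assume "CARD('a) = 25"
      then have "(5 :: 'a) * 5 = 0"
        using of_nat_CARD_eq_0[where 'a = 'a] by simp
      then show False
        using False by (simp only: mult_eq_0_iff) blast
    qed
    with assms(1,2,3) have large: "CARD('a) \<ge> 31"
      by presburger
    have "5 * (- \<kappa>) * v^3 - 5 * (- \<kappa>)^2 * v = - (20 * \<beta> * \<kappa>)"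
      using M[of 5] assms(3) power_sum_5[of m1 m2] cp(5) unfolding e v[symmetric] by simp
    then have "5 * \<kappa> * v * (v^2 - 3 * \<kappa>) = 0"
      unfolding \<beta> by algebra
    then have v2: "v^2 = 3 * \<kappa>"
      using False \<kappa> v0 by simp
    \<comment> \<open>Inserting \<open>v^2 = 3 * \<kappa>\<close> in the sixth moment yields only
      \<open>7 * \<kappa>^2 = 0\<close>, which is harmless in characteristic 7. The eighth moment
      yields \<open>576 * \<kappa>^4 = 0\<close> with \<open>576 = 2^6 * 3^2\<close>.\<close>
    have "8 * (- \<kappa>) * v^6 - 20 * (- \<kappa>)^2 * v^4 + 16 * (- \<kappa>)^3 * v^2 - 2 * (- \<kappa>)^4 =
        - (70 * \<kappa>^4 + 168 * \<alpha> * \<kappa>^2 + 168 * \<beta>^2 * \<kappa> + 28 * \<alpha>^2)"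
      using M[of 8] large power_sum_8[of m1 m2] cp(8) unfolding e v[symmetric] by simp
    then have "2 * 2 * 2 * (2 * 2 * 2 * 3 * 3) * \<kappa>^4 = 0"
      using v2 unfolding \<alpha> \<beta> by algebra
    then show False
      using two three \<kappa> by (simp only: mult_eq_0_iff power_eq_0_iff) blast
  qed
qed

text \<open>The first two moments give \<open>v = m1 + m2\<close> and \<open>m1 * m2 = 0\<close>, so
  \<open>v\<close> cancels one omitted value and the other one is 0. Hence the moment of order
  \<open>n = (q - 1) / 3\<close> vanishes, whereas the leading term of the \<open>n\<close>-th
  power, of degree \<open>q - 1\<close>, makes it \<open>- (\<alpha> ^ n)\<close>.\<close>

lemma card_image_cubic:
  fixes \<alpha> \<beta> \<kappa> :: "'a::{field,finite}"
  assumes "odd CARD('a)" "CARD('a) mod 3 = 1" "CARD('a) \<ge> 13" "\<alpha> \<noteq> 0"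
  shows "card ((\<lambda>s. \<alpha> * s^3 + \<beta> * s^2 + \<kappa> * s) ` (- {0})) \<le> CARD('a) - 3"
proof (rule ccontr)
  \<comment> \<open>\<open>P\<close> is \<open>s\<close> times \<open>Q\<close>. The form
    \<open>P(s) / s\<close> fits the general moment formula for orders 1 and 2; order
    \<open>n\<close> lies just outside its range and is computed from \<open>Q\<close>.\<close>
  define P where "P = [:0, 0, \<kappa>, \<beta>, \<alpha>:]"
  define Q where "Q = [:0, \<kappa>, \<beta>, \<alpha>:]"
  define n where "n = (CARD('a) - 1) div 3"
  have n: "3 * n = CARD('a) - 1" "0 < n"
    using assms(2,3) unfolding n_def by presburger+
  assume "\<not> ?thesis"
  moreover have Q: "poly P s / s = poly Q s" "poly Q s = \<alpha> * s^3 + \<beta> * s^2 + \<kappa> * s"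
    if "s \<in> - {0}" for s
    using that by (auto simp: P_def Q_def field_simps power2_eq_square power3_eq_cube)
  then have "(\<lambda>s. \<alpha> * s^3 + \<beta> * s^2 + \<kappa> * s) ` (- {0}) = (\<lambda>s. poly P s / s) ` (- {0})"
    by (intro image_cong) auto
  ultimately have deficient: "CARD('a) - 3 < card ((\<lambda>s. poly P s / s) ` (- {0}))"
    by simp
  have P: "degree P \<le> 4" "CARD('a) \<ge> 3"
    using assms(3) by (simp_all add: P_def)
  obtain v m1 m2 where M': "\<And>k. 0 < k \<Longrightarrow> k < CARD('a) - 1 \<Longrightarrow>
      (\<Sum>s\<in>- {0}. (poly P s / s) ^ k) = v ^ k - m1 ^ k - m2 ^ k"
    using deficient_moments[OF P(2) deficient] by blast
  have M: "v ^ k - m1 ^ k - m2 ^ k = - coeff (P ^ k) k" if "0 < k" "3 * k < CARD('a) - 1" for k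
    using M'[of k] that sum_power_poly_div[OF P(1) that(2)] by simp
  have two: "(2 :: 'a) \<noteq> 0"
    using assms(1) by (rule two_neq_0_if_odd_CARD)
  have v: "v = m1 + m2"
    using M[of 1] assms(3) by (simp add: P_def algebra_simps)
  have "coeff (P ^ 2) 2 = 0"
    by (simp add: P_def power2_eq_square numeral_2_eq_2)
  then have "v^2 - m1^2 - m2^2 = 0"
    using M[of 2] assms(3) by simp
  then have "2 * (m1 * m2) = 0"
    unfolding v by algebra
  then have "m1 = 0 \<or> m2 = 0"
    using two by (simp only: mult_eq_0_iff) blast
  then have "(\<Sum>s\<in>- {0}. (poly P s / s) ^ n) = 0"
    using M'[of n] n by (auto simp: v power_0_left)
  also have "(\<Sum>s\<in>- {0}. (poly P s / s) ^ n) = (\<Sum>s\<in>- {0}. poly (Q ^ n) s)"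
    using Q by (intro sum.cong) (auto simp: poly_power)
  also have "\<dots> = (\<Sum>s\<in>- {0}. \<Sum>i\<le>3 * n. coeff (Q ^ n) i * s ^ i)"
  proof (intro sum.cong refl)
    fix s
    have "degree Q \<le> 3"
      by (simp add: Q_def)
    then have "degree (Q ^ n) \<le> 3 * n"
      using degree_power_le[of Q n] by (meson le_trans mult_le_mono1)
    then show "poly (Q ^ n) s = (\<Sum>i\<le>3 * n. coeff (Q ^ n) i * s ^ i)"
      unfolding poly_altdef by (intro sum.mono_neutral_left) (auto simp: coeff_eq_0)
  qed
  also have "\<dots> = (\<Sum>i\<le>3 * n. coeff (Q ^ n) i * (\<Sum>s\<in>- {0}. s ^ i))"
    by (subst sum.swap) (simp add: sum_distrib_left)
  also have "\<dots> = (\<Sum>i\<le>3 * n. if i = 3 * n then - (\<alpha> ^ n) else 0)"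
  proof (intro sum.cong refl)
    fix i
    assume i: "i \<in> {..3 * n}"
    \<comment> \<open>Besides \<open>3 * n\<close>, the exponent 0 is also a multiple of
      \<open>q - 1\<close>; it does not contribute because \<open>Q\<close> vanishes at 0.\<close>
    have "coeff (Q ^ n) 0 = 0"
      using n by (simp add: coeff_0_power Q_def)
    moreover have "coeff (Q ^ n) (3 * n) = \<alpha> ^ n"
    proof -
      have "lead_coeff (Q ^ n) = lead_coeff Q ^ n"
        by (rule lead_coeff_power)
      moreover have "degree (Q ^ n) = 3 * n"
        using assms(4) by (subst degree_power_eq) (simp_all add: Q_def)
      ultimately show ?thesis
        using assms(4) by (simp add: Q_def)
    qed
    moreover have "3 * n dvd i \<longleftrightarrow> i = 0 \<or> i = 3 * n"
      using i n by (auto dest: dvd_imp_le)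
    moreover have "(\<Sum>s\<in>- {0 :: 'a}. s ^ i) = (if 3 * n dvd i then -1 else 0)"
      unfolding n(1) by (rule sum_powers_nonzero)
    ultimately show "coeff (Q ^ n) i * (\<Sum>s\<in>- {0}. s ^ i) = (if i = 3 * n then - (\<alpha> ^ n) else 0)"
      using n(2) by auto
  qed
  also have "\<dots> = - (\<alpha> ^ n)"
    by simp
  finally show False
    using assms(4) by simp
qed

section \<open>Prime fields by enumeration of residues\<close>

lemma inj_on_of_int_prime_CARD:
  assumes "prime CARD('a::{field,finite})"
  shows "inj_on (of_int :: int \<Rightarrow> 'a) {0..<int CARD('a)}"
proof (rule linorder_inj_onI')
  fix x y :: int
  assume xy: "x \<in> {0..<int CARD('a)}" "y \<in> {0..<int CARD('a)}" "x < y"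
  show "of_int x \<noteq> (of_int y :: 'a)"
  proof
    assume "of_int x = (of_int y :: 'a)"
    then have 0: "of_int (y - x) = (0 :: 'a)"
      by simp
    have "\<not> int CARD('a) dvd y - x"
      using xy by (auto dest: zdvd_imp_le)
    \<comment> \<open>A Bezout combination of \<open>q\<close> and \<open>y - x\<close> equals 1,
      but both map to 0 in the field.\<close>
    then have "coprime (int CARD('a)) (y - x)"
      using assms by (intro prime_imp_coprime) auto
    then obtain u v where "u * int CARD('a) + v * (y - x) = 1"
      using bezout_int[of "int CARD('a)" "y - x"] by (auto simp: coprime_iff_gcd_eq_1)
    then have "of_int (u * int CARD('a) + v * (y - x)) = (1 :: 'a)"
      by simp
    then show False
      unfolding of_int_add of_int_mult 0 by (simp add: of_nat_CARD_eq_0)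
  qed
qed

lemma of_int_image_prime_CARD:
  assumes "prime CARD('a::{field,finite})"
  shows "(of_int :: int \<Rightarrow> 'a) ` {0..<int CARD('a)} = UNIV"
  using card_image[OF inj_on_of_int_prime_CARD[OF assms]] by (intro card_subset_eq) auto

lemma of_int_mod_CARD: "of_int (x mod int CARD('a)) = (of_int x :: 'a::{field,finite})"
proof -
  have "of_int x = (of_int (int CARD('a) * (x div int CARD('a)) + x mod int CARD('a)) :: 'a)"
    by simp
  then show ?thesis
    unfolding of_int_add of_int_mult by (simp add: of_nat_CARD_eq_0)
qed

text \<open>The entries \<open>(i, j)\<close> of \<open>L\<close> are the nonzero residues modulo \<open>n\<close> with their inverses.\<close>
definition laurent_count :: "int \<Rightarrow> (int \<times> int) list \<Rightarrow> int \<Rightarrow> int \<Rightarrow> int \<Rightarrow> int" where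
  "laurent_count n L b k c =
    int (length (remdups (map (\<lambda>(i, j). (i * (i * (i + b) + k) + c * j) mod n) L)))"

text \<open>Rescaling makes the leading coefficient 1 and the quadratic coefficient 0 or 1, so only
  these \<open>b\<close> are tested, against all residues \<open>k\<close> and
  \<open>c\<close>.\<close>

definition laurent_check :: "int \<Rightarrow> (int \<times> int) list \<Rightarrow> bool" where
  "laurent_check n L \<longleftrightarrow> map fst L = [1..n - 1] \<and> (\<forall>(i, j)\<in>set L. i * j mod n = 1) \<and>
    (\<forall>b\<in>set [0, 1]. \<forall>k\<in>set [0..n - 1]. \<forall>c\<in>set [0..n - 1]. laurent_count n L b k c \<le> n - 3)"

lemma card_image_laurent_check:
  fixes \<beta> \<kappa> \<gamma> :: "'a::{field,finite}"
  assumes "prime CARD('a)" and "laurent_check (int CARD('a)) L" and "\<beta> = 0 \<or> \<beta> = 1"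
  shows "int (card ((\<lambda>s. s^3 + \<beta> * s^2 + \<kappa> * s + \<gamma> / s) ` (- {0}))) \<le> int CARD('a) - 3"
proof -
  define n where "n = int CARD('a)"
  have "\<kappa> \<in> of_int ` {0..<n}" "\<gamma> \<in> of_int ` {0..<n}"
    using of_int_image_prime_CARD[OF assms(1)] by (auto simp: n_def)
  then obtain k c where kc: "k \<in> {0..<n}" "\<kappa> = of_int k" "c \<in> {0..<n}" "\<gamma> = of_int c"
    by blast
  obtain b where b: "b \<in> {0, 1}" "\<beta> = of_int b"
    using assms(3) by force
  define H where "H = (\<lambda>(i, j). (i * (i * (i + b) + k) + c * j) mod n)"
  have L: "map fst L = [1..n - 1]" "\<And>i j. (i, j) \<in> set L \<Longrightarrow> i * j mod n = 1"
    and count: "int (length (remdups (map H L))) \<le> n - 3"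
    using assms(2) kc b unfolding n_def[symmetric] laurent_check_def laurent_count_def H_def by auto
  have "(\<lambda>s. s^3 + \<beta> * s^2 + \<kappa> * s + \<gamma> / s) ` (- {0}) \<subseteq> of_int ` set (map H L)"
  proof
    fix t
    assume "t \<in> (\<lambda>s. s^3 + \<beta> * s^2 + \<kappa> * s + \<gamma> / s) ` (- {0})"
    then obtain s where s: "s \<noteq> 0" "t = s^3 + \<beta> * s^2 + \<kappa> * s + \<gamma> / s"
      by auto
    have "s \<in> of_int ` {0..<n}"
      using of_int_image_prime_CARD[OF assms(1)] by (auto simp: n_def)
    then obtain i where i: "i \<in> {0..<n}" "s = of_int i"
      by blast
    with s have "i \<noteq> 0"
      by auto
    with i have "i \<in> set (map fst L)"
      unfolding L(1) by simp
    then obtain j where j: "(i, j) \<in> set L"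
      by auto
    have "of_int i * of_int j = (of_int (i * j mod n) :: 'a)"
      by (simp add: of_int_mod_CARD n_def)
    also have "\<dots> = 1"
      using L(2)[OF j] by simp
    finally have "1 / s = of_int j"
      using s i by (simp add: field_simps)
    then have "\<gamma> / s = \<gamma> * of_int j"
      by (metis mult.right_neutral times_divide_eq_right)
    then have "t = of_int (H (i, j))"
      unfolding s(2) H_def b(2) kc(2,4) i(2) prod.case n_def of_int_mod_CARD
      by (simp add: algebra_simps power2_eq_square power3_eq_cube)
    with j show "t \<in> of_int ` set (map H L)"
      by force
  qed
  then have "card ((\<lambda>s. s^3 + \<beta> * s^2 + \<kappa> * s + \<gamma> / s) ` (- {0})) \<le> card (of_int ` set (map H L) :: 'a set)"
    by (intro card_mono) auto
  also have "\<dots> \<le> card (set (map H L))"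
    by (intro card_image_le) auto
  also have "\<dots> = length (remdups (map H L))"
    by (simp only: length_remdups_card_conv)
  finally show ?thesis
    using count unfolding n_def by linarith
qed

lemma laurent_check_13:
  "laurent_check 13 [(1, 1), (2, 7), (3, 9), (4, 10), (5, 8), (6, 11), (7, 2), (8, 5), (9, 3),
    (10, 4), (11, 6), (12, 12)]"
  by code_simp

lemma laurent_check_19:
  "laurent_check 19 [(1, 1), (2, 10), (3, 13), (4, 5), (5, 4), (6, 16), (7, 11), (8, 12), (9, 17),
    (10, 2), (11, 7), (12, 8), (13, 3), (14, 15), (15, 14), (16, 6), (17, 9), (18, 18)]"
  by code_simp

section \<open>Normalisation of coefficients and the uniform bound on slopes\<close>

lemma card_image_rescale:
  fixes f h :: "'a::field \<Rightarrow> 'a"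
  assumes "c \<noteq> 0" "d \<noteq> 0" "\<And>s. s \<noteq> 0 \<Longrightarrow> h s = r + d * f (c * s)"
  shows "card (h ` (- {0})) = card (f ` (- {0}))"
proof -
  have *: "(*) c ` (- {0}) = - {0}"
  proof (intro equalityI subsetI)
    fix x :: 'a
    assume "x \<in> - {0}"
    then show "x \<in> (*) c ` (- {0})"
      using assms(1) by (intro image_eqI[of _ _ "x / c"]) auto
  qed (use assms(1) in auto)
  have "h ` (- {0}) = (\<lambda>x. r + d * x) ` f ` (*) c ` (- {0})"
    unfolding image_image by (intro image_cong) (auto simp: assms(3))
  moreover have "inj_on (\<lambda>x. r + d * x) (f ` (- {0}))"
    using assms(2) by (auto intro: inj_onI)
  ultimately show ?thesis
    by (simp only: * card_image)
qed

lemma card_image_laurent: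
  fixes \<alpha> \<beta> \<kappa> \<gamma> :: "'a::{field,finite}"
  assumes "odd CARD('a)" "CARD('a) mod 3 = 1" "CARD('a) \<ge> 13" "\<alpha> \<noteq> 0"
  shows "card ((\<lambda>s. \<alpha> * s^3 + \<beta> * s^2 + \<kappa> * s + \<gamma> / s) ` (- {0})) \<le> CARD('a) - 3"
    (is "card (?h ` _) \<le> _")
proof -
  consider "\<gamma> = 0" | "\<gamma> \<noteq> 0" "CARD('a) \<ge> 25" | "CARD('a) = 13 \<or> CARD('a) = 19"
  proof -
    \<comment> \<open>Being odd and 1 modulo 3, the order is 1 modulo 6; from 13 up to 24 this
      leaves 13 and 19.\<close>
    have "CARD('a) \<ge> 25 \<or> CARD('a) = 13 \<or> CARD('a) = 19"
      using assms(1-3) by presburger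
    then show thesis
      using that by blast
  qed
  then show ?thesis
  proof cases
    case 1
    then show ?thesis
      using card_image_cubic[OF assms] by simp
  next
    case 2
    have "card (?h ` (- {0})) =
        card ((\<lambda>s. \<alpha> / \<gamma> * s^3 + \<beta> / \<gamma> * s^2 + \<kappa> / \<gamma> * s + 1 / s) ` (- {0}))"
      using 2 by (intro card_image_rescale[of 1 \<gamma> _ 0]) (auto simp: field_simps)
    also have "\<dots> \<le> CARD('a) - 3"
      using assms 2 by (intro card_image_simple_pole) auto
    finally show ?thesis .
  next
    case 3
    have "\<exists>b k c. (b = 0 \<or> b = 1) \<and>
        card (?h ` (- {0})) = card ((\<lambda>s. s^3 + b * s^2 + k * s + c / s) ` (- {0 :: 'a}))"
    proof (cases "\<beta> = 0")
      case True
      have "card (?h ` (- {0})) =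
          card ((\<lambda>s. s^3 + 0 * s^2 + \<kappa> / \<alpha> * s + (\<gamma> / \<alpha>) / s) ` (- {0}))"
        using assms(4) True by (intro card_image_rescale[of 1 \<alpha> _ 0]) (auto simp: field_simps)
      then show ?thesis
        by blast
    next
      case False
      \<comment> \<open>Replacing \<open>s\<close> by \<open>r * s\<close> in a polynomial with
        cubic and quadratic coefficient 1, and multiplying by \<open>\<beta> / r^2\<close>, produces
        the coefficients \<open>\<beta> * r = \<alpha>\<close> and \<open>\<beta>\<close>.\<close>
      define r where "r = \<alpha> / \<beta>"
      have r: "r \<noteq> 0" "\<beta> * r = \<alpha>"
        using False assms(4) by (auto simp: r_def)
      have "card (?h ` (- {0})) =
          card ((\<lambda>s. s^3 + 1 * s^2 + \<kappa> * r / \<beta> * s + (\<gamma> * r^3 / \<beta>) / s) ` (- {0}))"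
        using r False
        by (intro card_image_rescale[of r "\<beta> / r^2" _ 0])
          (auto simp: field_simps power2_eq_square power3_eq_cube simp flip: r(2))
      then show ?thesis
        by blast
    qed
    then obtain b k c where b: "b = 0 \<or> b = 1" and
      eq: "card (?h ` (- {0})) = card ((\<lambda>s. s^3 + b * s^2 + k * s + c / s) ` (- {0 :: 'a}))"
      by blast
    have "prime (13 :: nat)" "prime (19 :: nat)"
      by simp_all
    with 3 have "prime CARD('a)" "\<exists>L. laurent_check (int CARD('a)) L"
      using laurent_check_13 laurent_check_19 by auto
    then show ?thesis
      unfolding eq using card_image_laurent_check[OF _ _ b, of _ k c] by force
  qed
qed

text \<open>Along a line of slope \<open>m\<close>, the polynomial \<open>g\<close> is a quartic in
  \<open>s\<close> with leading coefficient \<open>m^2\<close>, nonzero since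
  \<open>m \<noteq> 0\<close>. After subtraction of \<open>g a b\<close> and division by
  \<open>s\<close>, the constant \<open>r\<close> merely translates the values.\<close>

lemma slopes_le:
  fixes a b m e :: "'a::{field,finite}"
  assumes "odd CARD('a)" "CARD('a) mod 3 = 1" "CARD('a) \<ge> 13" "m \<noteq> 0"
  shows "slopes a b m e \<le> CARD('a) - 3"
proof -
  define \<beta> where "\<beta> = m + m^2 + 2 * m * (a * m + e)"
  define \<kappa> where "\<kappa> = e + 2*a*m + 2*e*m + a*m^2 + (a*m + e)^2 + 2*a*e*m"
  define r where "r = 2*a*e + a^2*m + e^2 + 2*a*e*m + 2*a*e*(a*m + e)"
  define \<gamma> where "\<gamma> = g a e - g a b"
  have "(g (a + s) (m * s + e) - g a b) / s = r + 1 * (m^2 * (1 * s)^3 + \<beta> * (1 * s)^2 + \<kappa> * (1 * s) + \<gamma> / (1 * s))"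
    if "s \<noteq> 0" for s
  proof -
    have "g (a + s) (m * s + e) - g a b = r * s + m^2 * s^4 + \<beta> * s^3 + \<kappa> * s^2 + \<gamma>"
      unfolding g_def r_def \<beta>_def \<kappa>_def \<gamma>_def by algebra
    then show ?thesis
      using that by (simp add: field_simps power4_eq_xxxx power3_eq_cube power2_eq_square)
  qed
  then have "slopes a b m e = card ((\<lambda>s. m^2 * s^3 + \<beta> * s^2 + \<kappa> * s + \<gamma> / s) ` (- {0}))"
    unfolding slopes_def by (intro card_image_rescale[of 1 1]) auto
  also have "\<dots> \<le> CARD('a) - 3"
    using assms by (intro card_image_laurent) auto
  finally show ?thesis .
qed

lemma slopes_le_CARD: "slopes a b m e \<le> CARD('a) - 1" for a b m e :: "'a::{field,finite}"
  unfolding slopes_def card_nonzero[symmetric] by (intro card_image_le) auto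

section \<open>The field with seven elements\<close>

text \<open>Here \<open>r\<^sub>3\<close> of \<open>[0,0,0]\<close> is 197 and the other values come close to it, so the number of slopes
  has to be summed exactly.  Residues are constructors rather than integers to keep the evaluation
  by rewriting cheap.\<close>

datatype z7 = Z0 | Z1 | Z2 | Z3 | Z4 | Z5 | Z6

primrec succ7 :: "z7 \<Rightarrow> z7" where
  "succ7 Z0 = Z1" | "succ7 Z1 = Z2" | "succ7 Z2 = Z3" | "succ7 Z3 = Z4"
| "succ7 Z4 = Z5" | "succ7 Z5 = Z6" | "succ7 Z6 = Z0"

primrec neg7 :: "z7 \<Rightarrow> z7" where
  "neg7 Z0 = Z0" | "neg7 Z1 = Z6" | "neg7 Z2 = Z5" | "neg7 Z3 = Z4"
| "neg7 Z4 = Z3" | "neg7 Z5 = Z2" | "neg7 Z6 = Z1"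

primrec add7 :: "z7 \<Rightarrow> z7 \<Rightarrow> z7" where
  "add7 Z0 y = y"
| "add7 Z1 y = succ7 y"
| "add7 Z2 y = succ7 (succ7 y)"
| "add7 Z3 y = succ7 (succ7 (succ7 y))"
| "add7 Z4 y = succ7 (succ7 (succ7 (succ7 y)))"
| "add7 Z5 y = succ7 (succ7 (succ7 (succ7 (succ7 y))))"
| "add7 Z6 y = succ7 (succ7 (succ7 (succ7 (succ7 (succ7 y)))))"

primrec mult7 :: "z7 \<Rightarrow> z7 \<Rightarrow> z7" where
  "mult7 Z0 y = Z0"
| "mult7 Z1 y = y"
| "mult7 Z2 y = add7 y y"
| "mult7 Z3 y = add7 y (add7 y y)"
| "mult7 Z4 y = neg7 (add7 y (add7 y y))"
| "mult7 Z5 y = neg7 (add7 y y)"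
| "mult7 Z6 y = neg7 y"

primrec int7 :: "z7 \<Rightarrow> int" where
  "int7 Z0 = 0" | "int7 Z1 = 1" | "int7 Z2 = 2" | "int7 Z3 = 3"
| "int7 Z4 = 4" | "int7 Z5 = 5" | "int7 Z6 = 6"

definition g7 :: "z7 \<Rightarrow> z7 \<Rightarrow> z7" where
  "g7 x y = mult7 (mult7 x y) (add7 x (add7 y (mult7 x y)))"

text \<open>The list pairs each nonzero residue with its inverse, turning division by
  \<open>s\<close> into multiplication by \<open>j\<close>.\<close>

definition slopes7 :: "z7 \<Rightarrow> z7 \<Rightarrow> z7 \<Rightarrow> z7 \<Rightarrow> nat" where
  "slopes7 a b m e = length (remdups (map
    (\<lambda>(s, j). mult7 j (add7 (neg7 (g7 a b)) (g7 (add7 a s) (add7 (mult7 m s) e))))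
    [(Z1, Z1), (Z2, Z4), (Z3, Z5), (Z4, Z2), (Z5, Z3), (Z6, Z6)]))"

definition all7 :: "z7 list" where
  "all7 = [Z0, Z1, Z2, Z3, Z4, Z5, Z6]"

text \<open>\<open>B\<close> stands for the negative of the second coordinate of the line, so
  \<open>add7 (mult7 A z) B\<close> is the height at \<open>z\<close>. As \<open>B\<close> runs over
  all residues, no line with nonzero \<open>A\<close> is lost.\<close>

lemma line_check_7:
  "\<forall>A\<in>set [Z1, Z2, Z3, Z4, Z5, Z6]. \<forall>B\<in>set all7.
    (\<Sum>z\<leftarrow>all7. \<Sum>w\<leftarrow>all7. if w = add7 (mult7 A z) B then 0 else slopes7 z w A (add7 (mult7 A z) B)) \<le> 196"
  by code_simp

lemma point_check_7:
  "\<forall>a\<in>set all7. \<forall>b\<in>set all7.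
    (\<Sum>m\<leftarrow>all7. \<Sum>e\<leftarrow>all7. if e = b then 0 else slopes7 a b m e) \<le> 196"
  by code_simp

lemma int7_range: "int7 x \<in> {0..<7}"
  by (cases x) simp_all

lemma inj_int7: "inj int7"
proof (rule injI)
  show "int7 x = int7 y \<Longrightarrow> x = y" for x y
    by (cases x; cases y; simp)
qed

lemma int7_surj: "i \<in> {0..<7} \<Longrightarrow> \<exists>x. i = int7 x"
proof -
  assume "i \<in> {0..<7}"
  then have "i = 0 \<or> i = 1 \<or> i = 2 \<or> i = 3 \<or> i = 4 \<or> i = 5 \<or> i = 6"
    by auto
  then show ?thesis
    by (metis int7.simps)
qed

lemma int7_neg7: "int7 (neg7 x) = - int7 x mod 7"
  by (cases x) simp_all

lemma int7_succ7: "int7 (succ7 x) = (1 + int7 x) mod 7"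
  by (cases x) simp_all

lemma int7_add7: "int7 (add7 x y) = (int7 x + int7 y) mod 7"
  by (cases x) (simp_all add: int7_succ7 mod_simps int7_range[simplified])

lemma int7_mult7: "int7 (mult7 x y) = (int7 x * int7 y) mod 7"
  by (cases x; cases y) simp_all

definition of_z7 :: "z7 \<Rightarrow> 'a::ring_1" where
  "of_z7 x = of_int (int7 x)"

lemma UNIV_z7: "UNIV = set all7"
proof -
  have "x \<in> set all7" for x
    by (cases x) (simp_all add: all7_def)
  then show ?thesis
    by auto
qed

lemma sum_UNIV_z7: "(\<Sum>x\<in>UNIV. f x) = (\<Sum>x\<leftarrow>all7. f x)"
  unfolding UNIV_z7 by (rule sum.distinct_set_conv_list) (simp add: all7_def)

context
  assumes CARD_7: "CARD('a::{field,finite}) = 7"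
begin

lemma of_int_mod_7: "of_int (x mod 7) = (of_int x :: 'a)"
  using of_int_mod_CARD[of x, where 'a = 'a] CARD_7 by simp

lemma of_z7_ops:
  "of_z7 (neg7 x) = - (of_z7 x :: 'a)"
  "of_z7 (add7 x y) = (of_z7 x + of_z7 y :: 'a)"
  "of_z7 (mult7 x y) = (of_z7 x * of_z7 y :: 'a)"
  by (simp_all add: of_z7_def int7_neg7 int7_add7 int7_mult7 of_int_mod_7)

lemma of_z7_g7: "of_z7 (g7 x y) = (g (of_z7 x) (of_z7 y) :: 'a)"
  by (simp add: g7_def g_def of_z7_ops algebra_simps)

lemma bij_of_z7: "bij (of_z7 :: z7 \<Rightarrow> 'a)"
proof -
  have p: "prime CARD('a)"
    using CARD_7 by simp
  show ?thesis
  proof (rule bijI)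
    show "inj (of_z7 :: z7 \<Rightarrow> 'a)"
    proof (rule injI)
      fix x y
      assume "of_z7 x = (of_z7 y :: 'a)"
      then have "int7 x = int7 y"
        using inj_on_of_int_prime_CARD[OF p] int7_range[of x] int7_range[of y]
        unfolding of_z7_def CARD_7 by (auto dest: inj_onD)
      then show "x = y"
        using inj_int7 by (auto dest: injD)
    qed
    show "surj (of_z7 :: z7 \<Rightarrow> 'a)"
    proof -
      have "\<exists>x. t = of_z7 x" for t :: 'a
      proof -
        obtain i where "i \<in> {0..<7}" "t = of_int i"
          using of_int_image_prime_CARD[OF p] unfolding CARD_7 by (metis UNIV_I imageE of_nat_numeral)
        then show ?thesis
          unfolding of_z7_def using int7_surj by blast
      qed
      then show ?thesis
        by (auto simp: surj_def)
    qed
  qed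
qed

lemma slopes_le_slopes7:
  "slopes (of_z7 a) (of_z7 b) (of_z7 m) (of_z7 e :: 'a) \<le> slopes7 a b m e"
proof -
  let ?L = "[(Z1, Z1), (Z2, Z4), (Z3, Z5), (Z4, Z2), (Z5, Z3), (Z6, Z6)]"
  define H where "H = (\<lambda>(s, j). mult7 j (add7 (neg7 (g7 a b)) (g7 (add7 a s) (add7 (mult7 m s) e))))"
  have "(g (of_z7 a + s) (of_z7 m * s + of_z7 e) - g (of_z7 a) (of_z7 b)) / s \<in> of_z7 ` set (map H ?L)"
    if s: "s \<noteq> 0" for s :: 'a
  proof -
    obtain i where i: "s = of_z7 i"
      using bij_of_z7 by (metis bij_pointE)
    with s have "i \<noteq> Z0"
      by (auto simp: of_z7_def)
    then obtain j where j: "(i, j) \<in> set ?L" "mult7 i j = Z1"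
      by (cases i) auto
    have "s * of_z7 j = of_z7 Z1"
      unfolding i of_z7_ops(3)[symmetric] j(2) ..
    then have "1 / s = of_z7 j"
      using s by (simp add: field_simps of_z7_def)
    then have "x / s = of_z7 j * x" for x
      by (metis mult.commute mult.right_neutral times_divide_eq_right)
    then have "(g (of_z7 a + s) (of_z7 m * s + of_z7 e) - g (of_z7 a) (of_z7 b)) / s = of_z7 (H (i, j))"
      unfolding H_def prod.case by (simp add: of_z7_ops of_z7_g7 i)
    with j(1) show ?thesis
      by (metis image_eqI list.set_map)
  qed
  then have "slopes (of_z7 a) (of_z7 b) (of_z7 m) (of_z7 e :: 'a) \<le> card (of_z7 ` set (map H ?L) :: 'a set)"
    unfolding slopes_def by (intro card_mono) auto
  also have "\<dots> \<le> card (set (map H ?L))"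
    by (intro card_image_le) simp
  also have "\<dots> = slopes7 a b m e"
    unfolding slopes7_def H_def by (simp only: length_remdups_card_conv)
  finally show ?thesis .
qed

lemma sum_of_z7: "(\<Sum>x\<in>UNIV. f x) = (\<Sum>x\<leftarrow>all7. f (of_z7 x :: 'a))" for f :: "'a \<Rightarrow> nat"
  unfolding sum_UNIV_z7[symmetric] using bij_of_z7 by (rule sum.reindex_bij_betw[symmetric])

lemma sum_Compl_of_z7:
  fixes f :: "'a \<Rightarrow> nat"
  shows "(\<Sum>x\<in>- {of_z7 y}. f x) = (\<Sum>x\<leftarrow>all7. if x = y then 0 else f (of_z7 x))"
proof -
  have "(\<Sum>x\<in>- {of_z7 y}. f x) = (\<Sum>x\<in>UNIV. if x = of_z7 y then 0 else f x)"
    by (intro sum.mono_neutral_cong_left) auto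
  also have "\<dots> = (\<Sum>x\<leftarrow>all7. if x = y then 0 else f (of_z7 x))"
    using bij_of_z7 unfolding sum_of_z7 by (simp add: bij_def inj_eq)
  finally show ?thesis .
qed

lemma r3_Point_7: "r\<^sub>3 (Point a b c :: 'a vertex) \<le> 196"
proof -
  obtain a' b' where ab: "a = of_z7 a'" "b = of_z7 b'"
    using bij_of_z7 by (metis bij_pointE)
  have "r\<^sub>3 (Point a b c) = (\<Sum>m\<leftarrow>all7. \<Sum>e\<leftarrow>all7. if e = b' then 0 else
      slopes (of_z7 a') (of_z7 b') (of_z7 m) (of_z7 e :: 'a))"
    unfolding r3_Point ab sum_of_z7 sum_Compl_of_z7 ..
  also have "\<dots> \<le> (\<Sum>m\<leftarrow>all7. \<Sum>e\<leftarrow>all7. if e = b' then 0 else slopes7 a' b' m e)"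
    using slopes_le_slopes7 by (intro sum_list_mono) auto
  also have "\<dots> \<le> 196"
    using point_check_7 UNIV_z7 by blast
  finally show ?thesis .
qed

lemma r3_Line_7:
  assumes "A \<noteq> 0"
  shows "r\<^sub>3 (Line A B C :: 'a vertex) \<le> 196"
proof -
  obtain A' B' where AB: "A = of_z7 A'" "- B = of_z7 B'"
    using bij_of_z7 by (metis bij_pointE)
  have B: "B = - of_z7 B'"
    using AB(2) by (metis minus_minus)
  have A': "A' \<in> set [Z1, Z2, Z3, Z4, Z5, Z6]"
    using assms AB by (cases A') (auto simp: of_z7_def)
  have *: "of_z7 A' * of_z7 z - - of_z7 B' = (of_z7 (add7 (mult7 A' z) B') :: 'a)" for z
    by (simp add: of_z7_ops)
  have "r\<^sub>3 (Line A B C) = (\<Sum>z\<leftarrow>all7. \<Sum>w\<leftarrow>all7. if w = add7 (mult7 A' z) B' then 0 else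
      slopes (of_z7 z) (of_z7 w) (of_z7 A') (of_z7 (add7 (mult7 A' z) B') :: 'a))"
    unfolding r3_Line AB(1) B sum_of_z7 * sum_Compl_of_z7 ..
  also have "\<dots> \<le> (\<Sum>z\<leftarrow>all7. \<Sum>w\<leftarrow>all7. if w = add7 (mult7 A' z) B' then 0 else
      slopes7 z w A' (add7 (mult7 A' z) B'))"
    using slopes_le_slopes7 by (intro sum_list_mono) auto
  also have "\<dots> \<le> 196"
    using line_check_7 A' UNIV_z7 by blast
  finally show ?thesis .
qed

end

section \<open>Comparison of the counts\<close>

lemma card_image_const_div:
  fixes c r :: "'a::{field,finite}"
  shows "card ((\<lambda>s. r + c / s) ` (- {0})) = (if c = 0 then 1 else CARD('a) - 1)"
proof (cases "c = 0")
  case True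
  have "(\<lambda>s. r) ` (- {0 :: 'a}) = {r}"
    by (rule image_constant[of 1]) simp
  with True show ?thesis
    by simp
next
  case False
  then have "inj_on (\<lambda>s. r + c / s) (- {0})"
    by (auto intro!: inj_onI)
  with False show ?thesis
    by (simp add: card_image card_nonzero)
qed

lemma sum_Compl_if_all:
  assumes "\<And>w. w \<noteq> c \<Longrightarrow> P w"
  shows "(\<Sum>w\<in>- {c :: 'a::{field,finite}}. if P w then x else y) = (CARD('a) - 1) * (x :: nat)"
proof -
  have "(\<Sum>w\<in>- {c}. if P w then x else y) = (\<Sum>w\<in>- {c}. x)"
    using assms by (intro sum.cong) auto
  then show ?thesis
    by (simp add: Compl_eq_Diff_UNIV card_Diff_subset)
qed

lemma sum_Compl_if_none:
  assumes "\<And>w. w \<noteq> c \<Longrightarrow> \<not> P w"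
  shows "(\<Sum>w\<in>- {c :: 'a::{field,finite}}. if P w then x else y) = (CARD('a) - 1) * (y :: nat)"
proof -
  have "(\<Sum>w\<in>- {c}. if P w then x else y) = (\<Sum>w\<in>- {c}. y)"
    using assms by (intro sum.cong) auto
  then show ?thesis
    by (simp add: Compl_eq_Diff_UNIV card_Diff_subset)
qed

lemma sum_Compl_if_one:
  assumes "\<And>w. w \<noteq> c \<Longrightarrow> P w \<longleftrightarrow> w = d" "d \<noteq> c"
  shows "(\<Sum>w\<in>- {c :: 'a::{field,finite}}. if P w then x else y) = x + (CARD('a) - 2) * (y :: nat)"
proof -
  have "(\<Sum>w\<in>- {c}. if P w then x else y) = (\<Sum>w\<in>insert d (- {c, d}). if w = d then x else y)"
    using assms by (intro sum.cong) auto
  also have "\<dots> = x + (\<Sum>w\<in>- {c, d}. if w = d then x else y)"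
    by (subst sum.insert) auto
  also have "(\<Sum>w\<in>- {c, d}. if w = d then x else y) = (\<Sum>w\<in>- {c, d}. y)"
    by (intro sum.cong) auto
  finally show ?thesis
    using assms(2) by (simp add: Compl_eq_Diff_UNIV card_Diff_subset numeral_2_eq_2)
qed

text \<open>On the axis \<open>g\<close> vanishes, so the slopes are \<open>- g z w / s\<close>: one
  value if \<open>g z w = 0\<close>, all nonzero values otherwise. With \<open>w \<noteq> 0\<close>,
  the zeros are all \<open>w\<close> for \<open>z = 0\<close>, none for \<open>z = - 1\<close>, and
  exactly one for every other \<open>z\<close>.\<close>

lemma r3_Line_0_0:
  assumes "CARD('a::{field,finite}) = q"
  shows "r\<^sub>3 (Line 0 0 C :: 'a vertex) = (q - 1) + (q - 1) * (q - 1) + (q - 2) * (1 + (q - 2) * (q - 1))"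
proof -
  have sl: "slopes z w 0 0 = (if g z w = 0 then 1 else q - 1)" for z w :: 'a
    unfolding slopes_def using card_image_const_div[of 0 "- g z w"] by (simp add: g_def assms)
  define f where "f z = (\<Sum>w\<in>- {0 :: 'a}. slopes z w 0 0)" for z
  have f0: "f 0 = q - 1"
    unfolding f_def sl using sum_Compl_if_all[of "0 :: 'a" "\<lambda>w. g 0 w = 0" 1 "q - 1"] by (simp add: g_def assms)
  have f1: "f (- 1) = (q - 1) * (q - 1)"
  proof -
    have "w \<noteq> 0 \<Longrightarrow> g (- 1) w \<noteq> 0" for w :: 'a
      by (simp add: g_def)
    then show ?thesis
      unfolding f_def sl assms[symmetric] by (rule sum_Compl_if_none)
  qed
  have fz: "f z = 1 + (q - 2) * (q - 1)" if z: "z \<in> - {0, - 1}" for z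
  proof -
    have z1: "1 + z \<noteq> 0" "z \<noteq> 0"
      using z by (auto simp: add_eq_0_iff)
    have "g z w = 0 \<longleftrightarrow> w = - z / (1 + z)" if "w \<noteq> 0" for w
    proof -
      have "g z w = z * w * (z + w * (1 + z))"
        by (simp add: g_def algebra_simps)
      then have "g z w = 0 \<longleftrightarrow> z + w * (1 + z) = 0"
        using z1 that by simp
      also have "\<dots> \<longleftrightarrow> w * (1 + z) = - z"
        by (rule add_eq_0_iff)
      also have "\<dots> \<longleftrightarrow> w = - z / (1 + z)"
        by (rule nonzero_eq_divide_eq[OF z1(1), symmetric])
      finally show ?thesis .
    qed
    moreover have "- z / (1 + z) \<noteq> 0"
      using z1 by simp
    ultimately show ?thesis
      unfolding f_def sl assms[symmetric] by (rule sum_Compl_if_one)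
  qed
  have "(\<Sum>z\<in>- {0, - 1}. f z) = (\<Sum>z\<in>- {0, - 1 :: 'a}. 1 + (q - 2) * (q - 1))"
    using fz by (rule sum.cong[OF refl])
  moreover have "card (- {0, - 1 :: 'a}) = q - 2"
    by (simp add: Compl_eq_Diff_UNIV card_Diff_subset assms numeral_2_eq_2)
  moreover have "(\<Sum>z\<in>UNIV. f z) = f 0 + (f (- 1) + (\<Sum>z\<in>- {0, - 1}. f z))"
  proof -
    have "(UNIV :: 'a set) = insert 0 (insert (- 1) (- {0, - 1}))"
      by auto
    then have "(\<Sum>z\<in>UNIV. f z) = (\<Sum>z\<in>insert 0 (insert (- 1) (- {0, - 1})). f z)"
      by (rule arg_cong)
    then show ?thesis
      by simp
  qed
  ultimately show ?thesis
    unfolding r3_Line by (simp add: f0 f1 flip: f_def)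
qed

text \<open>Since \<open>g x (- 1) = x\<close>, the slopes are \<open>1 + (z - g z w) / s\<close>.
  Compared with \<open>[0,0,C]\<close>, the column \<open>z = - 2\<close> is a further one without a
  degenerate \<open>w\<close>, which makes this count larger by \<open>q - 2\<close>.\<close>

lemma r3_Line_0_1:
  assumes "CARD('a::{field,finite}) = q" and two: "(2 :: 'a) \<noteq> 0"
  shows "r\<^sub>3 (Line 0 1 C :: 'a vertex) =
    (q - 1) + 2 * ((q - 1) * (q - 1)) + (q - 3) * (1 + (q - 2) * (q - 1))"
proof -
  have sl: "slopes z w 0 (- 1) = (if g z w = z then 1 else q - 1)" for z w :: 'a
  proof -
    have "(\<lambda>s. (g (z + s) (0 * s + - 1) - g z w) / s) ` (- {0}) = (\<lambda>s. 1 + (z - g z w) / s) ` (- {0})"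
      by (intro image_cong) (auto simp: g_def field_simps)
    then show ?thesis
      unfolding slopes_def by (simp add: card_image_const_div assms)
  qed
  define f where "f z = (\<Sum>w\<in>- {- 1 :: 'a}. slopes z w 0 (- 1))" for z
  have root: "g z w = z \<longleftrightarrow> (1 + z) * w = 1" if "w \<noteq> - 1" "z \<noteq> 0" for z w :: 'a
  proof -
    have "g z w - z = z * (w + 1) * ((1 + z) * w - 1)"
      by (simp add: g_def algebra_simps)
    moreover have "w + 1 \<noteq> 0"
      using that by (simp add: eq_neg_iff_add_eq_0)
    ultimately show ?thesis
      using that by (metis eq_iff_diff_eq_0 mult_eq_0_iff)
  qed
  have none: "f z = (q - 1) * (q - 1)" if "\<And>w. w \<noteq> - 1 \<Longrightarrow> g z w \<noteq> z" for z
    unfolding f_def sl assms(1)[symmetric] using that by (rule sum_Compl_if_none)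
  have f0: "f 0 = q - 1"
    unfolding f_def sl using sum_Compl_if_all[of "- 1 :: 'a" "\<lambda>w. g 0 w = 0" 1 "q - 1"] by (simp add: g_def assms)
  have f1: "f (- 1) = (q - 1) * (q - 1)"
    by (rule none) (simp add: root)
  \<comment> \<open>For \<open>z = - 2\<close> the equation \<open>(1 + z) * w = 1\<close> has only
    the solution \<open>w = - 1\<close>, which is excluded.\<close>
  have f2: "f (- 2) = (q - 1) * (q - 1)"
    using two by (intro none) (auto simp: root dest: arg_cong[of _ _ uminus])
  have fz: "f z = 1 + (q - 2) * (q - 1)" if z: "z \<in> - {0, - 1, - 2}" for z
  proof -
    have z1: "1 + z \<noteq> 0" "z \<noteq> 0" "2 + z \<noteq> 0"
      using z by (auto simp: add_eq_0_iff)
    have "g z w = z \<longleftrightarrow> w = 1 / (1 + z)" if "w \<noteq> - 1" for w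
      using root[OF that z1(2)] nonzero_eq_divide_eq[OF z1(1), of w 1] by (simp add: mult.commute)
    moreover have "1 / (1 + z) \<noteq> - 1"
    proof
      assume "1 / (1 + z) = - 1"
      then have "1 = - 1 * (1 + z)"
        using nonzero_divide_eq_eq[OF z1(1), of 1 "- 1"] by blast
      then have "2 + z = 0"
        by algebra
      with z1(3) show False ..
    qed
    ultimately show ?thesis
      unfolding f_def sl assms(1)[symmetric] by (rule sum_Compl_if_one)
  qed
  have distinct: "(0 :: 'a) \<noteq> - 1" "(- 1 :: 'a) \<noteq> - 2" "(0 :: 'a) \<noteq> - 2"
    using two by (auto simp: eq_neg_iff_add_eq_0)
  have "card {0, - 1, - 2 :: 'a} = 3"
    using distinct by (metis card_3_iff)
  then have c: "card (- {0, - 1, - 2 :: 'a}) = q - 3"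
    by (simp add: Compl_eq_Diff_UNIV card_Diff_subset assms)
  have "(\<Sum>z\<in>- {0, - 1, - 2}. f z) = (\<Sum>z\<in>- {0, - 1, - 2 :: 'a}. 1 + (q - 2) * (q - 1))"
    using fz by (rule sum.cong[OF refl])
  moreover have "(\<Sum>z\<in>UNIV. f z) = f 0 + (f (- 1) + (f (- 2) + (\<Sum>z\<in>- {0, - 1, - 2}. f z)))"
  proof -
    have "(UNIV :: 'a set) = insert 0 (insert (- 1) (insert (- 2) (- {0, - 1, - 2})))"
      by auto
    then have "(\<Sum>z\<in>UNIV. f z) = (\<Sum>z\<in>insert 0 (insert (- 1) (insert (- 2) (- {0, - 1, - 2}))). f z)"
      by (rule arg_cong)
    then show ?thesis
      using distinct by (simp only: sum.insert finite insert_iff Compl_iff empty_iff) simp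
  qed
  ultimately show ?thesis
    unfolding r3_Line by (simp add: f0 f1 f2 c flip: f_def)
qed

section \<open>The remaining horizontal lines\<close>

lemma card_image_two_to_one:
  fixes c d :: "'a::{field,finite}"
  assumes "c \<noteq> 0" "d \<noteq> 0"
  shows "2 * card ((\<lambda>s. c * s + d / s) ` (- {0})) \<le> CARD('a) + 1"
proof -
  define f where "f s = c * s + d / s" for s
  define I where "I = f ` (- {0})"
  \<comment> \<open>\<open>F\<close> is the set of fixed points of the involution sending
    \<open>s\<close> to \<open>d / (c * s)\<close>, which preserves \<open>f\<close>. Values not
    attained on \<open>F\<close> therefore have at least two preimages.\<close>
  define F where "F = {s. c * s^2 = d}"
  have "card F \<le> 2"
  proof -
    have "F = {s. poly [:- d, 0, c:] s = 0}"
      by (auto simp: F_def power2_eq_square algebra_simps)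
    moreover have "card {s. poly [:- d, 0, c:] s = 0} \<le> degree [:- d, 0, c:]"
      using assms by (intro card_poly_roots_bound) auto
    moreover have "degree [:- d, 0, c:] \<le> 2"
      by simp
    ultimately show ?thesis
      by (metis le_trans)
  qed
  have fiber: "2 \<le> card {s \<in> - {0}. f s = t}" if t: "t \<in> I - f ` F" for t
  proof -
    obtain s where s: "s \<noteq> 0" "t = f s" "s \<notin> F"
      using t by (auto simp: I_def)
    have "s \<noteq> d / (c * s)"
      using s assms by (auto simp: F_def field_simps power2_eq_square)
    moreover have "f (d / (c * s)) = f s" "d / (c * s) \<noteq> 0"
      using s assms by (auto simp: f_def field_simps)
    ultimately have "card {s, d / (c * s)} = 2" "{s, d / (c * s)} \<subseteq> {s \<in> - {0}. f s = t}"
      using s by auto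
    then show ?thesis
      by (metis card_mono finite)
  qed
  have fiber1: "1 \<le> card {s \<in> - {0}. f s = t}" if t: "t \<in> I" for t
    using t by (auto simp: I_def Suc_le_eq card_gt_0_iff)
  have "2 * card I \<le> 2 * card (I - f ` F) + 2 * card (I \<inter> f ` F)"
    using sum.Int_Diff[of I "\<lambda>_. 1 :: nat" "f ` F"] by simp
  also have "\<dots> \<le> (2 * card (I - f ` F) + card (I \<inter> f ` F)) + 2"
  proof -
    have "card (I \<inter> f ` F) \<le> card (f ` F)"
      by (intro card_mono) auto
    also have "\<dots> \<le> 2"
      using \<open>card F \<le> 2\<close> card_image_le[of F f] by simp
    finally show ?thesis
      by simp
  qed
  also have "2 * card (I - f ` F) + card (I \<inter> f ` F) \<le>
      (\<Sum>t\<in>I - f ` F. card {s \<in> - {0}. f s = t}) + (\<Sum>t\<in>I \<inter> f ` F. card {s \<in> - {0}. f s = t})"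
  proof (rule add_mono)
    show "2 * card (I - f ` F) \<le> (\<Sum>t\<in>I - f ` F. card {s \<in> - {0}. f s = t})"
      using sum_mono[of "I - f ` F" "\<lambda>_. 2", OF fiber] by (simp add: mult.commute)
    show "card (I \<inter> f ` F) \<le> (\<Sum>t\<in>I \<inter> f ` F. card {s \<in> - {0}. f s = t})"
      using sum_mono[of "I \<inter> f ` F" "\<lambda>_. 1", OF fiber1] by simp
  qed
  also have "\<dots> = (\<Sum>t\<in>I. card {s \<in> - {0}. f s = t})"
    by (simp add: sum.Int_Diff[of I _ "f ` F"])
  also have "\<dots> = CARD('a) - 1"
    using sum.image_gen[of "- {0}" "\<lambda>_. 1 :: nat" f] by (simp add: I_def card_nonzero)
  finally show ?thesis
    by (simp add: I_def f_def)
qed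

text \<open>At height \<open>- B\<close> the polynomial \<open>g\<close> is quadratic with leading
  coefficient \<open>- (B * (1 - B))\<close>, nonzero here. The slopes thus have the form
  \<open>c * s + d / s\<close> up to a constant, with at most \<open>(q + 1) / 2\<close> values when
  \<open>d \<noteq> 0\<close>. The trivial bound is used for \<open>z = 0\<close>, and for at most
  one \<open>w\<close> for each other \<open>z\<close>. Doubling avoids halves.\<close>

lemma r3_Line_0_other:
  fixes B :: "'a::{field,finite}"
  assumes "CARD('a) = q" "q \<ge> 3" "B \<noteq> 0" "B \<noteq> 1"
  shows "2 * r\<^sub>3 (Line 0 B C) \<le>
    2 * ((q - 1) * (q - 1)) + (q - 1) * (2 * (q - 1) + (q - 2) * (q + 1))"
proof -
  have sl: "2 * slopes z w 0 (- B) \<le> q + 1" if "g z w \<noteq> g z (- B)" for z w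
  proof -
    define c where "c = - (B * (1 - B))"
    define d where "d = g z (- B) - g z w"
    have "(g (z + s) (0 * s + - B) - g z w) / s =
        (2 * c * z + B^2) + 1 * (c * (1 * s) + d / (1 * s))" if "s \<noteq> 0" for s
    proof -
      have "g (z + s) (0 * s + - B) - g z w = (2 * c * z + B^2) * s + c * s^2 + d"
        unfolding g_def c_def d_def by algebra
      then show ?thesis
        using that by (simp add: field_simps power2_eq_square)
    qed
    then have "slopes z w 0 (- B) = card ((\<lambda>s. c * s + d / s) ` (- {0}))"
      unfolding slopes_def by (intro card_image_rescale[of 1 1]) auto
    then show ?thesis
      using card_image_two_to_one[of c d] assms that by (simp add: c_def d_def)
  qed
  have le: "slopes z w 0 (- B) \<le> q - 1" for z w
    using slopes_le_CARD[of z w 0 "- B"] assms by simp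
  define f where "f z = (\<Sum>w\<in>- {- B}. 2 * slopes z w 0 (- B))" for z
  have f0: "f 0 \<le> 2 * ((q - 1) * (q - 1))"
  proof -
    have "f 0 \<le> (\<Sum>w\<in>- {- B}. 2 * (q - 1))"
      unfolding f_def using le by (intro sum_mono) simp
    then show ?thesis
      by (simp add: Compl_eq_Diff_UNIV card_Diff_subset assms)
  qed
  have fz: "f z \<le> 2 * (q - 1) + (q - 2) * (q + 1)" if z: "z \<noteq> 0" for z
  proof -
    obtain w0 where w0: "w0 \<noteq> - B" "\<And>w. w \<noteq> - B \<Longrightarrow> w \<noteq> w0 \<Longrightarrow> g z w \<noteq> g z (- B)"
    proof -
      have *: "z + (1 + z) * (w - B) = 0" if "w \<noteq> - B" "g z w = g z (- B)" for w
      proof -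
        have "(w + B) * z * (z + (1 + z) * (w - B)) = g z w - g z (- B)"
          by (simp add: g_def algebra_simps)
        moreover have "w + B \<noteq> 0"
          using that by (simp add: eq_neg_iff_add_eq_0)
        ultimately show ?thesis
          using that z by (metis mult_eq_0_iff right_minus_eq)
      qed
      have uniq: "w = w'" if "w \<noteq> - B" "g z w = g z (- B)" "w' \<noteq> - B" "g z w' = g z (- B)" for w w'
      proof -
        have e: "z + (1 + z) * (w - B) = 0" "z + (1 + z) * (w' - B) = 0"
          using * that by auto
        then have "(1 + z) * (w - w') = 0"
          by algebra
        moreover have "1 + z \<noteq> 0"
          using e(1) z by auto
        ultimately show ?thesis
          by simp
      qed
      show thesis
      proof (cases "\<exists>w. w \<noteq> - B \<and> g z w = g z (- B)")
        case True
        then show thesis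
          using uniq that by blast
      next
        case False
        \<comment> \<open>Without an exceptional \<open>w\<close>, any element different from
          \<open>- B\<close> can serve as \<open>w0\<close>.\<close>
        have "1 - B \<noteq> - B"
          by simp
        then show thesis
          using False that by blast
      qed
    qed
    have "f z \<le> (\<Sum>w\<in>- {- B}. if w = w0 then 2 * (q - 1) else q + 1)"
      unfolding f_def using w0 sl le by (intro sum_mono) auto
    also have "\<dots> = 2 * (q - 1) + (q - 2) * (q + 1)"
      using w0(1) by (simp add: sum_Compl_if_one[of "- B" _ w0] assms)
    finally show ?thesis .
  qed
  have "2 * r\<^sub>3 (Line 0 B C) = (\<Sum>z\<in>UNIV. f z)"
    unfolding r3_Line f_def by (simp add: sum_distrib_left)
  also have "\<dots> = f 0 + (\<Sum>z\<in>- {0}. f z)"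
    by (simp add: sum.remove[of UNIV 0] Compl_eq_Diff_UNIV)
  also have "(\<Sum>z\<in>- {0}. f z) \<le> (\<Sum>z\<in>- {0 :: 'a}. 2 * (q - 1) + (q - 2) * (q + 1))"
    using fz by (intro sum_mono) auto
  also have "\<dots> = (q - 1) * (2 * (q - 1) + (q - 2) * (q + 1))"
    by (simp add: card_nonzero assms)
  finally show ?thesis
    using f0 by simp
qed

section \<open>Summation of the bounds and conclusion\<close>

lemma r3_Line_le:
  fixes A B C :: "'a::{field,finite}"
  assumes "odd CARD('a)" "CARD('a) mod 3 = 1" "CARD('a) = q" "q \<ge> 13" "A \<noteq> 0"
  shows "r\<^sub>3 (Line A B C) \<le> q * ((q - 1) * (q - 3))"
proof -
  have "r\<^sub>3 (Line A B C) \<le> (\<Sum>z\<in>(UNIV :: 'a set). \<Sum>w\<in>- {A * z - B}. q - 3)"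
    unfolding r3_Line using slopes_le[of A] assms by (intro sum_mono) auto
  also have "\<dots> = q * ((q - 1) * (q - 3))"
    by (simp add: Compl_eq_Diff_UNIV card_Diff_subset assms)
  finally show ?thesis .
qed

text \<open>The direction \<open>m = 0\<close> is not covered by the Laurent bound and receives the
  trivial one, \<open>q - 1\<close> slopes for each line.\<close>

lemma r3_Point_le:
  fixes a b c :: "'a::{field,finite}"
  assumes "odd CARD('a)" "CARD('a) mod 3 = 1" "CARD('a) = q" "q \<ge> 13"
  shows "r\<^sub>3 (Point a b c) \<le> (q - 1) * (q - 1) + (q - 1) * ((q - 1) * (q - 3))"
proof -
  have "r\<^sub>3 (Point a b c) = (\<Sum>e\<in>- {b}. slopes a b 0 e) + (\<Sum>m\<in>- {0}. \<Sum>e\<in>- {b}. slopes a b m e)"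
    unfolding r3_Point by (simp add: sum.remove[of UNIV 0] Compl_eq_Diff_UNIV)
  also have "\<dots> \<le> (\<Sum>e\<in>- {b}. q - 1) + (\<Sum>m\<in>- {0 :: 'a}. \<Sum>e\<in>- {b}. q - 3)"
    using slopes_le slopes_le_CARD assms by (intro add_mono sum_mono) auto
  also have "\<dots> = (q - 1) * (q - 1) + (q - 1) * ((q - 1) * (q - 3))"
    by (simp add: Compl_eq_Diff_UNIV card_Diff_subset assms)
  finally show ?thesis .
qed

theorem theorem3p2:
  fixes q p k :: nat
  assumes "prime p" and "odd p" and "k \<ge> 1" and "q = p ^ k"
    and "q \<ge> 7" and "[q = 1] (mod 3)"
    and "CARD('a::{field,finite}) = q"
  shows "(\<forall>A B C :: 'a. (A, B) \<noteq> (0, 0) \<and> (A, B) \<noteq> (0, 1) \<longrightarrow>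
            r\<^sub>3 (Line A B C) < r\<^sub>3 (Line 0 0 0 :: 'a vertex) \<and>
            r\<^sub>3 (Line 0 0 0 :: 'a vertex) < r\<^sub>3 (Line 0 1 0 :: 'a vertex)) \<and>
         (\<forall>p1 p2 p3 :: 'a. r\<^sub>3 (Point p1 p2 p3) < r\<^sub>3 (Line 0 0 0 :: 'a vertex))"
proof -
  note q = \<open>CARD('a) = q\<close>
  have "odd q"
    using assms(2,4) by simp
  have "q mod 3 = 1"
    using assms(6) by (simp add: cong_def)
  have field: "odd CARD('a)" "CARD('a) mod 3 = 1"
    using \<open>odd q\<close> \<open>q mod 3 = 1\<close> q by simp_all
  have small: "q = 7 \<or> q \<ge> 13"
    using \<open>odd q\<close> \<open>q mod 3 = 1\<close> \<open>q \<ge> 7\<close> by presburger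
  \<comment> \<open>Writing \<open>q = d + 7\<close> removes truncated subtraction and reduces the
    comparisons to polynomials in a natural number \<open>d\<close>.\<close>
  obtain d where d: "q = d + 7"
    using \<open>q \<ge> 7\<close> by (metis add.commute le_Suc_ex)
  have two: "(2 :: 'a) \<noteq> 0"
    using field(1) by (rule two_neq_0_if_odd_CARD)
  have r00: "r\<^sub>3 (Line 0 0 0 :: 'a vertex) = d^3 + 17 * d^2 + 99 * d + 197"
    unfolding r3_Line_0_0[OF q] d by (simp add: algebra_simps power2_eq_square power3_eq_cube)
  have "r\<^sub>3 (Line 0 1 0 :: 'a vertex) = d^3 + 17 * d^2 + 100 * d + 202"
    unfolding r3_Line_0_1[OF q two] d by (simp add: algebra_simps power2_eq_square power3_eq_cube)
  then have less: "r\<^sub>3 (Line 0 0 0 :: 'a vertex) < r\<^sub>3 (Line 0 1 0 :: 'a vertex)"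
    using r00 by simp
  have line: "r\<^sub>3 (Line A B C) < r\<^sub>3 (Line 0 0 0 :: 'a vertex)"
    if AB: "(A, B) \<noteq> (0, 0)" "(A, B) \<noteq> (0, 1)" for A B C :: 'a
  proof (cases "A = 0")
    case True
    with AB have "2 * r\<^sub>3 (Line A B C) \<le> 2 * ((q - 1) * (q - 1)) + (q - 1) * (2 * (q - 1) + (q - 2) * (q + 1))"
      using r3_Line_0_other[OF q, of B C] \<open>q \<ge> 7\<close> by auto
    also have "\<dots> < 2 * r\<^sub>3 (Line 0 0 0 :: 'a vertex)"
      unfolding r00 d by (simp add: algebra_simps power2_eq_square power3_eq_cube)
    finally show ?thesis
      by simp
  next
    case False
    show ?thesis
    proof (cases "q = 7")
      case True
      then show ?thesis
        using r3_Line_7[of A B C] False q r00 d by simp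
    next
      case False
      then have "r\<^sub>3 (Line A B C) \<le> q * ((q - 1) * (q - 3))"
        using r3_Line_le[OF field q] small \<open>A \<noteq> 0\<close> by simp
      \<comment> \<open>The bound is \<open>q^3 - 4*q^2 + 3*q\<close> against
        \<open>q^3 - 4*q^2 + 8*q - 6\<close>: the two leading terms agree. With only two omitted
        slopes the bound would be \<open>q^3 - 3*q^2 + 2*q\<close>, which is too large.\<close>
      also have "\<dots> < r\<^sub>3 (Line 0 0 0 :: 'a vertex)"
        unfolding r00 d by (simp add: algebra_simps power2_eq_square power3_eq_cube)
      finally show ?thesis .
    qed
  qed
  have point: "r\<^sub>3 (Point a b c) < r\<^sub>3 (Line 0 0 0 :: 'a vertex)" for a b c :: 'a
  proof (cases "q = 7")
    case True
    then show ?thesis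
      using r3_Point_7[of a b c] q r00 d by simp
  next
    case False
    then have "r\<^sub>3 (Point a b c) \<le> (q - 1) * (q - 1) + (q - 1) * ((q - 1) * (q - 3))"
      using r3_Point_le[OF field q] small by simp
    also have "\<dots> < r\<^sub>3 (Line 0 0 0 :: 'a vertex)"
      unfolding r00 d by (simp add: algebra_simps power2_eq_square power3_eq_cube)
    finally show ?thesis .
  qed
  show ?thesis
    using line less point by blast
qed

end
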